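(* Let $d\ge1$ and let $q\in\mathbb N$ be large enough (depending on $d$). Then there is a uniform local algorithm $\mathcal A$ on $\mathbb{Z}^d$ that produces a $q$-toast and whose coding radius $\widetilde R(\mathcal A)$ satisfies $$\mathrm P\left(\widetilde R(\mathcal A)>(1/\varepsilon)\,2^{O(\sqrt{\log 1/\varepsilon})}\right)<\varepsilon ,$$ that is, there is a constant $K$ such that $\mathrm P\big(\widetilde R(\mathcal A)>(1/\varepsilon)2^{K\sqrt{\log 1/\varepsilon}}\big)<\varepsilon$ for all sufficiently small $\varepsilon>0$.
   Context: $\mathbb{Z}^d$ denotes the infinite grid: the Cayley graph of the group $\mathbb{Z}^d$ with respect to the standard generators, each edge being oriented and labelled by its generator; $d(\cdot,\cdot)$ is graph distance. A $q$-toast on $\mathbb{Z}^d$ is a collection $\mathcal D$ of finite connected subsets of $\mathbb{Z}^d$ such that (i) for all $g,h\in\mathbb{Z}^d$ there is $D\in\mathcal D$ with $g,h\in D$, and (ii) if $D,E\in\mathcal D$ and $d(\partial D,\partial E)<q$ then $D=E$, where $\partial D$ is the boundary of $D$ (vertices of $D$ with a neighbor outside $D$). A uniform local algorithm is run on $\mathbb{Z}^d$ whose vertices carry independent uniform random labels from $[0,1]$: each vertex explores balls of increasing radius around itself until the labelled ball (up to isomorphism, not depending on its position) belongs to a prescribed collection, and then it outputs a value that is a measurable function of that labelled ball. The algorithm produces a $q$-toast if with probability $1$ there is a $q$-toast $\mathcal D$ such that every vertex $v$ computes (as a subset positioned relative to $v$) the minimal piece $D\in\mathcal D$ with $v\in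 D$. $\widetilde R(\mathcal A)$ denotes the corresponding coding radius, i.e. the random minimal radius a vertex has to explore in order to output this piece. *)

theory Defs
  imports "HOL-Probability.Probability" "HOL-Library.Extended_Nat"
begin

text \<open>
  The vertices of the grid of dimension \<open>d = CARD('d)\<close> are the elements of the group
  \<open>int ^ 'd\<close>; as \<open>'d\<close> is nonempty, \<open>d \<ge> 1\<close>.
\<close>

definition grid_edge :: "'d::finite \<Rightarrow> int ^ 'd \<Rightarrow> int ^ 'd \<Rightarrow> bool" where
  "grid_edge i x y \<longleftrightarrow> y = x + axis i 1"

definition grid_adj :: "((int ^ 'd::finite) \<times> (int ^ 'd)) set" where
  "grid_adj = {(x, y). \<exists>i. grid_edge i x y \<or> grid_edge i y x}"

definition grid_dist :: "int ^ 'd::finite \<Rightarrow> int ^ 'd \<Rightarrow> nat" where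
  "grid_dist x y = (LEAST n. (x, y) \<in> grid_adj ^^ n)"

definition grid_ball :: "int ^ 'd::finite \<Rightarrow> nat \<Rightarrow> (int ^ 'd) set" where
  "grid_ball v r = {u. grid_dist v u \<le> r}"

definition set_dist :: "(int ^ 'd::finite) set \<Rightarrow> (int ^ 'd) set \<Rightarrow> enat" where
  "set_dist A B = (INF x\<in>A. INF y\<in>B. enat (grid_dist x y))"

definition boundary :: "(int ^ 'd::finite) set \<Rightarrow> (int ^ 'd) set" where
  "boundary D = {x \<in> D. \<exists>y. (x, y) \<in> grid_adj \<and> y \<notin> D}"

definition grid_connected :: "(int ^ 'd::finite) set \<Rightarrow> bool" where
  "grid_connected D \<longleftrightarrow> D \<noteq> {} \<and> (\<forall>x\<in>D. \<forall>y\<in>D. (x, y) \<in> (grid_adj \<inter> D \<times> D)\<^sup>*)"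

definition is_toast :: "nat \<Rightarrow> (int ^ 'd::finite) set set \<Rightarrow> bool" where
  "is_toast q \<D> \<longleftrightarrow>
     (\<forall>D\<in>\<D>. finite D \<and> grid_connected D) \<and>
     (\<forall>g h. \<exists>D\<in>\<D>. g \<in> D \<and> h \<in> D) \<and>
     (\<forall>D\<in>\<D>. \<forall>E\<in>\<D>. set_dist (boundary D) (boundary E) < enat q \<longrightarrow> D = E)"

text \<open>
  The minimal piece containing \<open>v\<close> is the least one with respect to inclusion. For families of
  finite sets this is the same as being the only inclusion-minimal piece containing \<open>v\<close>.
\<close>

definition minimal_piece :: "(int ^ 'd::finite) set set \<Rightarrow> int ^ 'd \<Rightarrow> (int ^ 'd) set \<Rightarrow> bool" where
  "minimal_piece \<D> v D \<longleftrightarrow> D \<in> \<D> \<and> v \<in> D \<and> (\<forall>E\<in>\<D>. v \<in> E \<longrightarrow> D \<subseteq> E)"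

abbreviation unif :: "real measure" where
  "unif \<equiv> uniform_measure lborel {0..1}"

definition labellings :: "(int ^ 'd::finite \<Rightarrow> real) measure" where
  "labellings = Pi\<^sub>M UNIV (\<lambda>_. unif)"

definition ball_labellings :: "nat \<Rightarrow> (int ^ 'd::finite \<Rightarrow> real) measure" where
  "ball_labellings r = Pi\<^sub>M (grid_ball 0 r) (\<lambda>_. unif)"

text \<open>
  The labelled ball of radius \<open>r\<close> around \<open>v\<close>, translated to the origin. Isomorphisms of rooted
  balls preserve the orientation and the generators of the edges, so they are translations, and
  the translated ball represents the isomorphism class of the labelled ball; see
  \<open>view_eq_iff_isomorphic\<close> below.
\<close>

definition view :: "(int ^ 'd::finite \<Rightarrow> real) \<Rightarrow> int ^ 'd \<Rightarrow> nat \<Rightarrow> (int ^ 'd \<Rightarrow> real)" where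
  "view x v r = restrict (\<lambda>u. x (v + u)) (grid_ball 0 r)"

text \<open>
  \<open>stops A r\<close> is the set of labelled balls of radius \<open>r\<close> in the prescribed collection and
  \<open>out A r\<close> is the output function on them.
\<close>

record ('d::finite, 'b) local_alg =
  stops :: "nat \<Rightarrow> (int ^ 'd \<Rightarrow> real) set"
  out :: "nat \<Rightarrow> (int ^ 'd \<Rightarrow> real) \<Rightarrow> 'b"

definition uniform_local_algorithm :: "'b measure \<Rightarrow> ('d::finite, 'b) local_alg \<Rightarrow> bool" where
  "uniform_local_algorithm N A \<longleftrightarrow>
     (\<forall>r. stops A r \<in> sets (ball_labellings r)) \<and>
     (\<forall>r. out A r \<in> measurable (restrict_space (ball_labellings r) (stops A r)) N)"

text \<open>The coding radius is \<open>\<infinity>\<close> if the exploration from \<open>v\<close> never stops.\<close>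

definition coding_radius ::
    "('d::finite, 'b) local_alg \<Rightarrow> (int ^ 'd \<Rightarrow> real) \<Rightarrow> int ^ 'd \<Rightarrow> enat" where
  "coding_radius A x v = (INF r\<in>{r. view x v r \<in> stops A r}. enat r)"

definition computes ::
    "('d::finite, 'b) local_alg \<Rightarrow> (int ^ 'd \<Rightarrow> real) \<Rightarrow> int ^ 'd \<Rightarrow> 'b \<Rightarrow> bool" where
  "computes A x v b \<longleftrightarrow> (\<exists>r. coding_radius A x v = enat r \<and> out A r (view x v r) = b)"

text \<open>
  A toast algorithm outputs finite sets positioned relative to the vertex. There are countably
  many of them, whence the discrete sigma-algebra.
\<close>

definition produces_toast :: "nat \<Rightarrow> ('d::finite, (int ^ 'd) set) local_alg \<Rightarrow> bool" where
  "produces_toast q A \<longleftrightarrow>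
     uniform_local_algorithm (count_space {D. finite D}) A \<and>
     (AE x in labellings. \<exists>\<D>. is_toast q \<D> \<and>
        (\<forall>v. \<exists>D. minimal_piece \<D> v D \<and> computes A x v ((\<lambda>u. u - v) ` D)))"

lemma grid_adj_translate: "(a + x, a + y) \<in> grid_adj \<longleftrightarrow> (x, y) \<in> grid_adj"
  by (auto simp: grid_adj_def grid_edge_def algebra_simps)

lemma grid_path_translate: "(x, y) \<in> grid_adj ^^ n \<Longrightarrow> (a + x, a + y) \<in> grid_adj ^^ n"
proof (induction n arbitrary: y)
  case (Suc n)
  then obtain z where "(x, z) \<in> grid_adj ^^ n" "(z, y) \<in> grid_adj" by auto
  with Suc.IH show ?case using grid_adj_translate[of a z y] by auto
qed simp

lemma grid_dist_translate: "grid_dist (a + x) (a + y) = grid_dist x y"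
proof -
  have "(a + x, a + y) \<in> grid_adj ^^ n \<longleftrightarrow> (x, y) \<in> grid_adj ^^ n" for n
    using grid_path_translate[of x y n a] grid_path_translate[of "a + x" "a + y" n "- a"]
    by auto
  then show ?thesis by (simp add: grid_dist_def)
qed

lemma grid_path_exists:
  fixes x y :: "int ^ 'd::finite"
  shows "\<exists>n. (x, y) \<in> grid_adj ^^ n"
proof -
  have line_nat: "(x, x + axis i (int k)) \<in> grid_adj\<^sup>*" for x :: "int ^ 'd" and i k
  proof (induction k)
    case 0
    have ax: "axis i 0 = (0 :: int ^ 'd)" by (simp add: vec_eq_iff axis_def)
    show ?case by (simp add: ax)
  next
    case (Suc k)
    have "x + axis i (int (Suc k)) = (x + axis i (int k)) + axis i 1"
      by (auto simp: vec_eq_iff axis_def)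
    then have "(x + axis i (int k), x + axis i (int (Suc k))) \<in> grid_adj"
      by (auto simp: grid_adj_def grid_edge_def)
    with Suc show ?case by (rule rtrancl_into_rtrancl)
  qed
  have "sym (grid_adj :: ((int ^ 'd) \<times> (int ^ 'd)) set)"
    by (auto simp: sym_def grid_adj_def)
  then have sym: "sym ((grid_adj :: ((int ^ 'd) \<times> (int ^ 'd)) set)\<^sup>*)"
    by (rule sym_rtrancl)
  have line: "(x, x + axis i c) \<in> grid_adj\<^sup>*" for x :: "int ^ 'd" and i and c :: int
  proof (cases "c \<ge> 0")
    case True
    then show ?thesis using line_nat[of x i "nat c"] by simp
  next
    case False
    have "x + axis i c + axis i (- c) = x" by (simp add: vec_eq_iff axis_def)
    with False line_nat[of "x + axis i c" i "nat (- c)"]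
    show ?thesis using symD[OF sym] by simp
  qed
  have "finite S \<Longrightarrow> (x, x + (\<Sum>i\<in>S. axis i ((y - x) $ i))) \<in> grid_adj\<^sup>*" for S
  proof (induction S rule: finite_induct)
    case (insert i S)
    have "x + (\<Sum>j\<in>insert i S. axis j ((y - x) $ j)) =
        (x + (\<Sum>j\<in>S. axis j ((y - x) $ j))) + axis i ((y - x) $ i)"
      using insert.hyps by (simp add: add.assoc add.commute)
    then show ?case using insert.IH line by (metis rtrancl_trans)
  qed simp
  moreover have "(\<Sum>i\<in>UNIV. axis i ((y - x) $ i)) = y - x"
    by (simp add: vec_eq_iff axis_def)
  ultimately have "(x, y) \<in> grid_adj\<^sup>*" by (metis add.commute diff_add_cancel finite_class.finite_UNIV)
  then show ?thesis by (simp add: rtrancl_power)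
qed

lemma grid_dist_path: "(x, y) \<in> grid_adj ^^ grid_dist x y"
  unfolding grid_dist_def using grid_path_exists by (rule LeastI_ex)

lemma grid_dist_le: "(x, y) \<in> grid_adj ^^ n \<Longrightarrow> grid_dist x y \<le> n"
  unfolding grid_dist_def by (rule Least_le)

lemma grid_ball_translate: "v + u \<in> grid_ball v r \<longleftrightarrow> u \<in> grid_ball 0 r"
  using grid_dist_translate[of v 0 u] by (simp add: grid_ball_def)

lemma view_eq_iff_isomorphic:
  "view x v r = view y w r \<longleftrightarrow>
     (\<exists>\<phi>. bij_betw \<phi> (grid_ball v r) (grid_ball w r) \<and> \<phi> v = w \<and>
        (\<forall>i. \<forall>a\<in>grid_ball v r. \<forall>b\<in>grid_ball v r. grid_edge i (\<phi> a) (\<phi> b) \<longleftrightarrow> grid_edge i a b) \<and>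
        (\<forall>a\<in>grid_ball v r. y (\<phi> a) = x a))"
  (is "?L \<longleftrightarrow> (\<exists>\<phi>. ?iso \<phi>)")
proof
  assume eq: ?L
  define \<phi> where "\<phi> a = w + (a - v)" for a
  have mem: "a \<in> grid_ball v r \<longleftrightarrow> a - v \<in> grid_ball 0 r" for a
    using grid_ball_translate[of v "a - v" r] by simp
  have mem': "\<phi> a \<in> grid_ball w r \<longleftrightarrow> a \<in> grid_ball v r" for a
    using grid_ball_translate[of w "a - v" r] by (simp add: \<phi>_def mem)
  have "bij_betw \<phi> (grid_ball v r) (grid_ball w r)"
  proof (rule bij_betw_byWitness[where f' = "\<lambda>b. v + (b - w)"])
    show "\<phi> ` grid_ball v r \<subseteq> grid_ball w r" using mem' by blast
    show "(\<lambda>b. v + (b - w)) ` grid_ball w r \<subseteq> grid_ball v r"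
    proof (rule image_subsetI)
      fix b assume "b \<in> grid_ball w r"
      moreover have "\<phi> (v + (b - w)) = b" by (simp add: \<phi>_def)
      ultimately show "v + (b - w) \<in> grid_ball v r" using mem'[of "v + (b - w)"] by simp
    qed
  qed (simp_all add: \<phi>_def)
  moreover have "y (\<phi> a) = x a" if "a \<in> grid_ball v r" for a
    using fun_cong[OF eq, of "a - v"] that by (simp add: view_def \<phi>_def mem)
  ultimately have "?iso \<phi>"
    by (auto simp: \<phi>_def grid_edge_def algebra_simps)
  then show "\<exists>\<phi>. ?iso \<phi>" by (rule exI[where x = \<phi>])
next
  assume "\<exists>\<phi>. ?iso \<phi>"
  then obtain \<phi> where iso: "?iso \<phi>" ..
  have step: "n \<le> r \<Longrightarrow> (v, u) \<in> grid_adj ^^ n \<Longrightarrow> \<phi> u = w + (u - v)" for n u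
  proof (induction n arbitrary: u)
    case 0
    then show ?case using iso by simp
  next
    case (Suc n)
    then obtain z where z: "(v, z) \<in> grid_adj ^^ n" "(z, u) \<in> grid_adj" by auto
    have "z \<in> grid_ball v r" "u \<in> grid_ball v r"
      using grid_dist_le[OF z(1)] grid_dist_le[OF Suc.prems(2)] Suc.prems(1)
      by (auto simp: grid_ball_def)
    moreover have "\<phi> z = w + (z - v)" using Suc z by simp
    moreover obtain i where "grid_edge i z u \<or> grid_edge i u z"
      using z(2) by (auto simp: grid_adj_def)
    ultimately have "grid_edge i (w + (z - v)) (\<phi> u) \<and> grid_edge i z u \<or>
        grid_edge i (\<phi> u) (w + (z - v)) \<and> grid_edge i u z"
      using iso by metis
    then show ?case by (auto simp: grid_edge_def algebra_simps)
  qed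
  have "y (w + u) = x (v + u)" if "u \<in> grid_ball 0 r" for u
  proof -
    have "v + u \<in> grid_ball v r" using that by (simp add: grid_ball_translate)
    with iso step[OF _ grid_dist_path, of "v + u"] show ?thesis
      by (metis add_diff_cancel_left' grid_ball_def mem_Collect_eq)
  qed
  then show ?L by (auto simp: view_def restrict_def)
qed

lemma view_measurable: "(\<lambda>x. view x v r) \<in> measurable labellings (ball_labellings r)"
  unfolding view_def labellings_def ball_labellings_def
  by (intro measurable_restrict measurable_component_singleton) auto

lemma coding_radius_le_iff:
  "coding_radius A x v \<le> enat n \<longleftrightarrow> (\<exists>r\<le>n. view x v r \<in> stops A r)"
proof
  assume le: "coding_radius A x v \<le> enat n"
  show "\<exists>r\<le>n. view x v r \<in> stops A r"
  proof (rule ccontr)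
    assume "\<not> ?thesis"
    then have "enat (Suc n) \<le> coding_radius A x v"
      unfolding coding_radius_def by (intro INF_greatest) (auto simp: not_less_eq_eq)
    with le have "enat (Suc n) \<le> enat n" by (rule order_trans[rotated])
    then show False by simp
  qed
next
  assume "\<exists>r\<le>n. view x v r \<in> stops A r"
  then obtain r where r: "r \<le> n" "view x v r \<in> stops A r" by blast
  then have "coding_radius A x v \<le> enat r"
    unfolding coding_radius_def by (intro INF_lower) auto
  also have "\<dots> \<le> enat n" using r by simp
  finally show "coding_radius A x v \<le> enat n" .
qed

lemma coding_radius_event_measurable:
  assumes "uniform_local_algorithm N A"
  shows "{x \<in> space labellings. ereal_of_enat (coding_radius A x v) > ereal c} \<in> sets labellings"
proof -
  have [measurable]: "Measurable.pred labellings (\<lambda>x. view x v r \<in> stops A r)" for r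
  proof -
    have "(\<lambda>x. view x v r) -` stops A r \<inter> space labellings \<in> sets labellings"
      using assms view_measurable[of v r]
      by (intro measurable_sets) (auto simp: uniform_local_algorithm_def)
    then show ?thesis by (simp add: pred_def vimage_def Int_def conj_commute)
  qed
  have "ereal_of_enat R > ereal c \<longleftrightarrow> \<not> (\<exists>n. real n \<le> c \<and> R \<le> enat n)" for R
  proof (cases R)
    case (enat k)
    have "c < real k \<longleftrightarrow> \<not> (\<exists>n. real n \<le> c \<and> k \<le> n)"
      by (meson not_le of_nat_mono order_trans order_refl)
    with enat show ?thesis by simp
  qed simp
  then have "{x \<in> space labellings. ereal_of_enat (coding_radius A x v) > ereal c} =
      {x \<in> space labellings. \<not> (\<exists>n. real n \<le> c \<and> (\<exists>r\<le>n. view x v r \<in> stops A r))}"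
    by (simp add: coding_radius_le_iff)
  also have "\<dots> \<in> sets labellings" by measurable
  finally show ?thesis .
qed

end

theory Submission
  imports Defs
begin

text \<open>
  At level \<open>i\<close> all vertices \<open>u\<close> carry independent random weights \<open>\<delta> u\<close>, at most of the order of a scale
  \<open>r\<^sub>i = 2\<^bsup>i\<^sup>2 + O(i)\<^esup>\<close>, and compete for \<open>v\<close> with the score \<open>\<delta> u - d(u, v)\<close>. The set where \<open>u\<close> wins by
  a gap \<open>s\<^sub>i\<close>, a multiple of \<open>r\<^bsub>i-1\<^esub>\<close>, is star-shaped around \<open>u\<close>, hence connected, and the sets of
  different winners are \<open>s\<^sub>i\<close> apart. There is room to enlarge these cores so that they swallow or
  avoid the pieces of all lower levels, which yields a toast.

  Most vertices have weight 0. The others are of a type \<open>a \<le> i\<close>: their weights are uniform in an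
  interval of length \<open>h\<^sub>a\<close>, and they have density of the order of \<open>h\<^sub>a\<^bsup>-d\<^esup>\<close>, where \<open>h\<^sub>a\<close> grows by a
  factor 4 with each type up to \<open>h\<^sub>i = r\<^sub>i\<close>. If the winner at \<open>v\<close> is of type \<open>a\<close>, then larger types are
  absent near \<open>v\<close>, which has probability \<open>8\<^bsup>-(i-a)\<^esup>\<close> at most, and the gap is small with
  probability \<open>O(s\<^sub>i / h\<^sub>a) = O(4\<^bsup>i-a\<^esup> s\<^sub>i / r\<^sub>i)\<close>. So \<open>v\<close> is in no core of level \<open>i\<close> with probability \<open>O(s\<^sub>i / r\<^sub>i)\<close>,
  although the weights are bounded by \<open>O(r\<^sub>i)\<close>; a logarithmic loss in this bound, as for truncated
  exponential weights, would spoil the tail. As \<open>s\<^sub>i / r\<^sub>i = O(4\<^bsup>-i\<^esup>)\<close> and the levels are independent, \<open>v\<close> is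
  in no piece of the first \<open>k\<close> levels with probability \<open>2\<^bsup>-k\<^sup>2 + O(k)\<^esup>\<close>, while these pieces are
  determined within the radius \<open>2\<^bsup>k\<^sup>2 + O(k)\<^esup>\<close>.
\<close>

section \<open>Grid metric and connectivity\<close>

lemma grid_adj_sym: "(x, y) \<in> grid_adj \<longleftrightarrow> (y, x) \<in> grid_adj"
  by (auto simp: grid_adj_def)

lemma grid_path_sym: "(x, y) \<in> grid_adj ^^ n \<Longrightarrow> (y, x) \<in> grid_adj ^^ n"
proof (induction n arbitrary: y)
  case (Suc n)
  then obtain z where "(x, z) \<in> grid_adj ^^ n" "(z, y) \<in> grid_adj" by auto
  with Suc.IH have "(z, x) \<in> grid_adj ^^ n" "(y, z) \<in> grid_adj" by (auto simp: grid_adj_sym)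
  then show ?case by (metis relpow_Suc_I2)
qed simp

lemma grid_dist_sym: "grid_dist x y = grid_dist y x"
  by (meson grid_dist_le grid_dist_path grid_path_sym le_antisym)

lemma grid_dist_self [simp]: "grid_dist x x = 0"
  using grid_dist_le[of x x 0] by simp

lemma grid_dist_triangle: "grid_dist x z \<le> grid_dist x y + grid_dist y z"
proof -
  have "(x, z) \<in> grid_adj ^^ grid_dist x y O grid_adj ^^ grid_dist y z"
    using grid_dist_path by (rule relcompI) (rule grid_dist_path)
  then show ?thesis by (intro grid_dist_le) (simp add: relpow_add)
qed

lemma grid_dist_pred:
  assumes "grid_dist u v = Suc n"
  shows "\<exists>z. grid_dist u z = n \<and> (z, v) \<in> grid_adj"
proof -
  have "(u, v) \<in> grid_adj ^^ Suc n" using grid_dist_path[of u v] assms by simp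
  then obtain z where z: "(u, z) \<in> grid_adj ^^ n" "(z, v) \<in> grid_adj" by auto
  then have "grid_dist z v \<le> 1" using grid_dist_le[of z v 1] by simp
  with z assms grid_dist_le[of u z n] grid_dist_triangle[of u v z] have "grid_dist u z = n" by simp
  with z show ?thesis by blast
qed

lemma grid_dist_adj: "(x, y) \<in> grid_adj \<Longrightarrow> grid_dist x y \<le> 1"
  using grid_dist_le[of x y 1] by simp

lemma grid_dist_eq_0_iff [simp]: "grid_dist x y = 0 \<longleftrightarrow> x = y"
  using grid_dist_path[of x y] by auto

lemma component_le_grid_dist: "\<bar>(y - x) $ i\<bar> \<le> int (grid_dist x y)"
proof -
  have "(x, y) \<in> grid_adj ^^ n \<Longrightarrow> \<bar>(y - x) $ i\<bar> \<le> int n" for n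
  proof (induction n arbitrary: y)
    case (Suc n)
    then obtain z where z: "(x, z) \<in> grid_adj ^^ n" "(z, y) \<in> grid_adj" by auto
    have "\<bar>(y - z) $ i\<bar> \<le> 1"
      using z(2) by (auto simp: grid_adj_def grid_edge_def axis_def)
    with Suc.IH[OF z(1)] show ?case by simp
  qed simp
  then show ?thesis using grid_dist_path by blast
qed

lemma grid_dist_axis_le: "grid_dist x (x + axis i c) \<le> nat \<bar>c\<bar>"
proof -
  have ax: "axis i 0 = (0 :: int ^ 'd)" for i :: "'d::finite" by (simp add: vec_eq_iff axis_def)
  have pos: "grid_dist x (x + axis i (int k)) \<le> k" for k :: nat and x :: "int ^ 'd::finite" and i
  proof (induction k)
    case (Suc k)
    have "x + axis i (int (Suc k)) = (x + axis i (int k)) + axis i 1"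
      by (auto simp: vec_eq_iff axis_def)
    then have "(x + axis i (int k), x + axis i (int (Suc k))) \<in> grid_adj"
      by (auto simp: grid_adj_def grid_edge_def)
    from grid_dist_adj[OF this] Suc show ?case
      using grid_dist_triangle[of x "x + axis i (int (Suc k))" "x + axis i (int k)"] by simp
  qed (simp add: ax)
  show ?thesis
  proof (cases "c \<ge> 0")
    case True
    then show ?thesis using pos[of x i "nat c"] by simp
  next
    case False
    have "x + axis i c + axis i (- c) = x" by (simp add: vec_eq_iff axis_def)
    with False pos[of "x + axis i c" i "nat (- c)"] show ?thesis
      by (simp add: grid_dist_sym)
  qed
qed

lemma grid_dist_le_sum: "grid_dist x y \<le> (\<Sum>i\<in>UNIV. nat \<bar>(y - x) $ i\<bar>)"
proof -
  have "finite S \<Longrightarrow> grid_dist x (x + (\<Sum>i\<in>S. axis i ((y - x) $ i))) \<le> (\<Sum>i\<in>S. nat \<bar>(y - x) $ i\<bar>)"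
    for S
  proof (induction S rule: finite_induct)
    case (insert i S)
    let ?z = "x + (\<Sum>j\<in>S. axis j ((y - x) $ j))"
    have eq1: "x + (\<Sum>j\<in>insert i S. axis j ((y - x) $ j)) = ?z + axis i ((y - x) $ i)"
      using insert.hyps by (simp add: add.assoc add.commute)
    have eq2: "(\<Sum>j\<in>insert i S. nat \<bar>(y - x) $ j\<bar>) = (\<Sum>j\<in>S. nat \<bar>(y - x) $ j\<bar>) + nat \<bar>(y - x) $ i\<bar>"
      using insert.hyps by simp
    show ?case
      unfolding eq1 eq2
      by (rule order_trans[OF grid_dist_triangle add_mono[OF insert.IH grid_dist_axis_le]])
  qed simp
  from this[of UNIV] have "grid_dist x (x + (\<Sum>i\<in>UNIV. axis i ((y - x) $ i))) \<le> (\<Sum>i\<in>UNIV. nat \<bar>(y - x) $ i\<bar>)"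
    by simp
  moreover have "(\<Sum>i\<in>UNIV. axis i ((y - x) $ i)) = y - x"
    by (simp add: vec_eq_iff axis_def)
  ultimately show ?thesis by simp
qed

section \<open>Cardinalities of boxes and balls\<close>

lemma card_box:
  "card {x :: int ^ 'd::finite. \<forall>i. a $ i \<le> x $ i \<and> x $ i \<le> a $ i + int k} = (k + 1) ^ CARD('d)"
  "finite {x :: int ^ 'd::finite. \<forall>i. a $ i \<le> x $ i \<and> x $ i \<le> a $ i + int k}"
proof -
  let ?B = "{x :: int ^ 'd. \<forall>i. a $ i \<le> x $ i \<and> x $ i \<le> a $ i + int k}"
  let ?F = "PiE (UNIV :: 'd set) (\<lambda>i. {a $ i..a $ i + int k})"
  have "bij_betw vec_lambda ?F ?B"
    by (rule bij_betw_byWitness[where f' = vec_nth]) (auto simp: PiE_iff)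
  moreover have "card ?F = (k + 1) ^ CARD('d)" by (subst card_PiE) (auto simp: nat_add_distrib)
  moreover have "finite ?F" by (intro finite_PiE) auto
  ultimately show "card ?B = (k + 1) ^ CARD('d)" "finite ?B"
    using bij_betw_same_card[of vec_lambda ?F ?B] bij_betw_finite[of vec_lambda ?F ?B] by simp_all
qed

lemma grid_ball_subset_box:
  "grid_ball v n \<subseteq> {x :: int ^ 'd::finite. \<forall>i. (v - vec (int n)) $ i \<le> x $ i \<and> x $ i \<le> (v - vec (int n)) $ i + int (2 * n)}"
proof
  fix x assume "x \<in> grid_ball v n"
  then have "\<bar>(x - v) $ i\<bar> \<le> int n" for i
    using component_le_grid_dist[of x v i] by (simp add: grid_ball_def)
  from this[unfolded abs_le_iff vector_minus_component]
  have "x $ i - v $ i \<le> int n" "- (x $ i - v $ i) \<le> int n" for i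
    by auto
  then show "x \<in> {x. \<forall>i. (v - vec (int n)) $ i \<le> x $ i \<and> x $ i \<le> (v - vec (int n)) $ i + int (2 * n)}"
    by (simp add: algebra_simps)
qed

lemma finite_grid_ball [simp]: "finite (grid_ball v n)"
  using grid_ball_subset_box card_box(2) by (rule finite_subset)

lemma card_grid_ball_le: "card (grid_ball (v :: int ^ 'd::finite) n) \<le> (2 * n + 1) ^ CARD('d)"
  using card_mono[OF card_box(2) grid_ball_subset_box[of v n]]
  by (simp only: card_box(1)[of "v - vec (int n)" "2 * n"])

lemma card_grid_ball_ge:
  assumes "CARD('d) * k \<le> n"
  shows "(k + 1) ^ CARD('d) \<le> card (grid_ball (v :: int ^ 'd::finite) n)"
proof -
  have "{x. \<forall>i. v $ i \<le> x $ i \<and> x $ i \<le> v $ i + int k} \<subseteq> grid_ball v n"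
  proof
    fix x assume x: "x \<in> {x. \<forall>i. v $ i \<le> x $ i \<and> x $ i \<le> v $ i + int k}"
    have "grid_dist v x \<le> (\<Sum>i\<in>UNIV. nat \<bar>(x - v) $ i\<bar>)" by (rule grid_dist_le_sum)
    also have "\<dots> \<le> (\<Sum>i\<in>(UNIV :: 'd set). k)" using x by (intro sum_mono) (simp add: nat_le_iff abs_le_iff diff_le_eq add.commute)
    finally show "x \<in> grid_ball v n" using assms by (simp add: grid_ball_def)
  qed
  from card_mono[OF finite_grid_ball this] show ?thesis using card_box(1)[of v k] by simp
qed

section \<open>Neighbourhoods and connected sets\<close>

definition nbhd :: "nat \<Rightarrow> (int ^ 'd::finite) set \<Rightarrow> (int ^ 'd) set" where
  "nbhd r X = {v. \<exists>x\<in>X. grid_dist x v \<le> r}"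

lemma subset_nbhd: "X \<subseteq> nbhd r X"
  unfolding nbhd_def by (auto intro!: bexI)

lemma nbhd_mono: "X \<subseteq> Y \<Longrightarrow> r \<le> r' \<Longrightarrow> nbhd r X \<subseteq> nbhd r' Y"
  unfolding nbhd_def by (auto intro: order_trans)

lemma nbhd_nbhd: "nbhd r (nbhd r' X) \<subseteq> nbhd (r + r') X"
proof
  fix v assume "v \<in> nbhd r (nbhd r' X)"
  then obtain x y where x: "x \<in> X" "grid_dist x y \<le> r'" "grid_dist y v \<le> r" by (auto simp: nbhd_def)
  then have "grid_dist x v \<le> r + r'" using grid_dist_triangle[of x v y] by simp
  with x show "v \<in> nbhd (r + r') X" by (auto simp: nbhd_def)
qed

lemma nbhd_ball: "X \<subseteq> grid_ball u n \<Longrightarrow> nbhd r X \<subseteq> grid_ball u (n + r)"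
  unfolding nbhd_def grid_ball_def
proof safe
  fix v x assume "X \<subseteq> {w. grid_dist u w \<le> n}" "x \<in> X" "grid_dist x v \<le> r"
  then have "grid_dist u x \<le> n" "grid_dist x v \<le> r" by auto
  then show "grid_dist u v \<le> n + r" using grid_dist_triangle[of u v x] by simp
qed

abbreviation path_in :: "(int ^ 'd::finite) set \<Rightarrow> ((int ^ 'd) \<times> (int ^ 'd)) set" where
  "path_in D \<equiv> (grid_adj \<inter> D \<times> D)\<^sup>*"

lemma path_in_sym: "(x, y) \<in> path_in D \<Longrightarrow> (y, x) \<in> path_in D"
  by (rule symD[OF sym_rtrancl]) (auto simp: sym_def grid_adj_sym)

lemma path_in_mono: "D \<subseteq> E \<Longrightarrow> (x, y) \<in> path_in D \<Longrightarrow> (x, y) \<in> path_in E"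
  using rtrancl_mono[of "grid_adj \<inter> D \<times> D" "grid_adj \<inter> E \<times> E"] by blast

lemma grid_connectedI:
  assumes "x \<in> D" "\<And>y. y \<in> D \<Longrightarrow> (x, y) \<in> path_in D"
  shows "grid_connected D"
  unfolding grid_connected_def using assms by (auto intro: rtrancl_trans[OF path_in_sym])

text \<open>Induction on the distance from \<open>u\<close>: a set closed under steps towards
  \<open>u\<close> contains a whole geodesic from \<open>u\<close> to each of its points. It serves
  for balls and for cores alike.\<close>

lemma geodesic_path:
  assumes step: "\<And>z v. v \<in> D \<Longrightarrow> (z, v) \<in> grid_adj \<Longrightarrow> grid_dist u v = Suc (grid_dist u z) \<Longrightarrow> z \<in> D"
    and "v \<in> D"
  shows "u \<in> D \<and> (u, v) \<in> path_in D"
  using \<open>v \<in> D\<close>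
proof (induction "grid_dist u v" arbitrary: v)
  case 0
  then show ?case by simp
next
  case (Suc n)
  then obtain z where z: "grid_dist u z = n" "(z, v) \<in> grid_adj" by (metis grid_dist_pred)
  with Suc step have "z \<in> D" by metis
  with Suc z have "u \<in> D" "(u, z) \<in> path_in D" by auto
  moreover have "(z, v) \<in> grid_adj \<inter> D \<times> D" using z \<open>z \<in> D\<close> Suc by auto
  ultimately show ?case by (meson rtrancl.rtrancl_into_rtrancl)
qed

lemma grid_connected_nbhd:
  assumes "grid_connected E"
  shows "grid_connected (nbhd r E)"
proof -
  from assms obtain x where x: "x \<in> E" by (auto simp: grid_connected_def)
  show ?thesis
  proof (rule grid_connectedI)
    show "x \<in> nbhd r E" using x subset_nbhd by blast
    fix y assume "y \<in> nbhd r E"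
    then obtain e where e: "e \<in> E" "grid_dist e y \<le> r" by (auto simp: nbhd_def)
    have sub: "grid_ball e r \<subseteq> nbhd r E" using e by (auto simp: grid_ball_def nbhd_def)
    have "(e, y) \<in> path_in (grid_ball e r)"
      using geodesic_path[of "grid_ball e r" e y] e by (auto simp: grid_ball_def)
    then have "(e, y) \<in> path_in (nbhd r E)" using sub path_in_mono by blast
    moreover have "(x, e) \<in> path_in (nbhd r E)"
    proof (rule path_in_mono[OF subset_nbhd])
      show "(x, e) \<in> path_in E" using assms x e unfolding grid_connected_def by blast
    qed
    ultimately show "(x, y) \<in> path_in (nbhd r E)" by (rule rtrancl_trans[rotated])
  qed
qed

lemma grid_connected_Union:
  assumes "grid_connected X"
    and F: "\<And>Y. Y \<in> F \<Longrightarrow> grid_connected Y \<and> X \<inter> Y \<noteq> {}"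
  shows "grid_connected (X \<union> \<Union>F)"
proof -
  from assms obtain x where x: "x \<in> X" by (auto simp: grid_connected_def)
  have inX: "(x, y) \<in> path_in (X \<union> \<Union>F)" if "y \<in> X" for y
  proof (rule path_in_mono[of X])
    show "(x, y) \<in> path_in X" using assms(1) x that unfolding grid_connected_def by blast
  qed auto
  show ?thesis
  proof (rule grid_connectedI)
    show "x \<in> X \<union> \<Union>F" using x by blast
    fix y assume y: "y \<in> X \<union> \<Union>F"
    show "(x, y) \<in> path_in (X \<union> \<Union>F)"
    proof (cases "y \<in> X")
      case False
      with y obtain Y where Y: "Y \<in> F" "y \<in> Y" by blast
      with F obtain z where z: "z \<in> X" "z \<in> Y" by blast
      have "(z, y) \<in> path_in Y" using F[OF Y(1)] Y z unfolding grid_connected_def by blast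
      then have "(z, y) \<in> path_in (X \<union> \<Union>F)" by (rule path_in_mono[rotated]) (use Y in auto)
      with inX[OF z(1)] show ?thesis by (rule rtrancl_trans)
    qed (use inX in auto)
  qed
qed

section \<open>The deterministic construction of the pieces\<close>

text \<open>Scores \<open>\<delta> u - d(u, v)\<close> are compared with all differences moved
  across, as subtraction on \<open>nat\<close> truncates. The first conjunct is a contest against an
  idle rival of constant score 0; it keeps the core inside a ball around \<open>u\<close>.\<close>

definition core :: "nat \<Rightarrow> (int ^ 'd::finite \<Rightarrow> nat) \<Rightarrow> int ^ 'd \<Rightarrow> (int ^ 'd) set" where
  "core s \<delta> u = {v. grid_dist u v + s \<le> \<delta> u \<and>
     (\<forall>w. w \<noteq> u \<longrightarrow> \<delta> w + grid_dist u v + s \<le> \<delta> u + grid_dist w v)}"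

text \<open>A step towards \<open>u\<close> raises the score of \<open>u\<close> by exactly 1 and
  that of any rival by at most 1, so no gap shrinks.\<close>

lemma core_towards_center:
  assumes "v \<in> core s \<delta> u" "(z, v) \<in> grid_adj" "grid_dist u v = Suc (grid_dist u z)"
  shows "z \<in> core s \<delta> u"
proof -
  have "\<delta> w + grid_dist u z + s \<le> \<delta> u + grid_dist w z" if "w \<noteq> u" for w
  proof -
    have "\<delta> w + grid_dist u v + s \<le> \<delta> u + grid_dist w v"
      using assms(1) that by (simp add: core_def)
    moreover have "grid_dist w v \<le> grid_dist w z + 1"
      using grid_dist_triangle[of w v z] grid_dist_adj[OF assms(2)] by linarith
    ultimately show ?thesis using assms(3) by linarith
  qed
  moreover have "grid_dist u z + s \<le> \<delta> u"
    using assms(1,3) by (simp add: core_def)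
  ultimately show ?thesis by (simp add: core_def)
qed

lemma center_in_core: "core s \<delta> u \<noteq> {} \<Longrightarrow> u \<in> core s \<delta> u"
  using geodesic_path[of "core s \<delta> u" u] core_towards_center by blast

lemma grid_connected_core:
  assumes "core s \<delta> u \<noteq> {}"
  shows "grid_connected (core s \<delta> u)"
proof (rule grid_connectedI[OF center_in_core[OF assms]])
  fix v assume "v \<in> core s \<delta> u"
  then show "(u, v) \<in> path_in (core s \<delta> u)"
    using geodesic_path[of "core s \<delta> u" u v] core_towards_center by blast
qed

lemma core_subset_ball: "\<delta> u \<le> m \<Longrightarrow> core s \<delta> u \<subseteq> grid_ball u m"
  by (auto simp: core_def grid_ball_def)

text \<open>Each centre leads by \<open>s\<close> at its own point, so the difference of the two
  scores changes by at least \<open>2 * s\<close> between \<open>v\<close> and \<open>v'\<close>;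
  one step changes it by at most 2.\<close>

lemma core_separated:
  assumes "v \<in> core s \<delta> u" "v' \<in> core s \<delta> u'" "u \<noteq> u'"
  shows "s \<le> grid_dist v v'"
proof -
  have "\<delta> u' + grid_dist u v + s \<le> \<delta> u + grid_dist u' v"
    "\<delta> u + grid_dist u' v' + s \<le> \<delta> u' + grid_dist u v'"
    using assms by (auto simp: core_def)
  moreover have "grid_dist u v' \<le> grid_dist u v + grid_dist v v'"
    "grid_dist u' v \<le> grid_dist u' v' + grid_dist v v'"
    using grid_dist_triangle[of u v' v] grid_dist_triangle[of u' v v'] by (simp_all add: grid_dist_sym)
  ultimately show ?thesis by linarith
qed

text \<open>Within distance \<open>n\<close> a difference of two scores changes by at most
  \<open>2 * n\<close>, so a surplus gap puts a whole ball into the core.\<close>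

lemma core_shrink_gap:
  assumes "v \<in> core (s + 2 * n) \<delta> u"
  shows "grid_ball v n \<subseteq> core s \<delta> u"
proof
  fix x assume "x \<in> grid_ball v n"
  then have x: "grid_dist v x \<le> n" by (simp add: grid_ball_def)
  have u: "grid_dist u x \<le> grid_dist u v + n" using x grid_dist_triangle[of u x v] by linarith
  have "\<delta> w + grid_dist u x + s \<le> \<delta> u + grid_dist w x" if "w \<noteq> u" for w
  proof -
    have "\<delta> w + grid_dist u v + (s + 2 * n) \<le> \<delta> u + grid_dist w v"
      using assms that by (simp add: core_def)
    moreover have "grid_dist w v \<le> grid_dist w x + n"
      using x grid_dist_triangle[of w v x] by (simp add: grid_dist_sym)
    ultimately show ?thesis using u by linarith
  qed
  moreover have "grid_dist u x + s \<le> \<delta> u" using assms u by (simp add: core_def)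
  ultimately show "x \<in> core s \<delta> u" by (simp add: core_def)
qed

text \<open>A rival of weight at most \<open>m\<close> has a negative score beyond distance
  \<open>m\<close>, and a core reaches at most \<open>m\<close> from its centre. So only weights
  within \<open>2 * m\<close> count.\<close>

lemma core_local:
  assumes "\<And>w. w \<in> grid_ball u (2 * m) \<Longrightarrow> \<delta> w = \<delta>' w"
    and "\<And>w. \<delta> w \<le> m" "\<And>w. \<delta>' w \<le> m"
  shows "core s \<delta> u = core s \<delta>' u"
proof -
  have "core s \<delta> u \<subseteq> core s \<delta>' u"
    if eq: "\<And>w. w \<in> grid_ball u (2 * m) \<Longrightarrow> \<delta> w = \<delta>' w" and le: "\<And>w. \<delta> w \<le> m" "\<And>w. \<delta>' w \<le> m"
    for \<delta> \<delta>' :: "int ^ 'a \<Rightarrow> nat"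
  proof
    fix v assume v: "v \<in> core s \<delta> u"
    have eu: "\<delta>' u = \<delta> u" using eq[of u] by (simp add: grid_ball_def)
    have near: "grid_dist u v + s \<le> \<delta> u" using v by (simp add: core_def)
    have "\<delta>' w + grid_dist u v + s \<le> \<delta>' u + grid_dist w v" if "w \<noteq> u" for w
    proof (cases "grid_dist w v \<le> m")
      case True
      have "grid_dist u w \<le> 2 * m"
        using near le(1)[of u] True grid_dist_triangle[of u w v] by (simp add: grid_dist_sym)
      then have "\<delta> w = \<delta>' w" using eq by (simp add: grid_ball_def)
      then show ?thesis using v that eu by (auto simp: core_def)
    next
      case False
      then show ?thesis using near eu le(2)[of w] by linarith
    qed
    with near eu show "v \<in> core s \<delta>' u" by (simp add: core_def)
  qed
  from this[of \<delta> \<delta>'] this[of \<delta>' \<delta>] assms show ?thesis by auto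
qed

lemma image_plus_nbhd: "nbhd r ((+) a ` X) = (+) a ` nbhd r X"
proof -
  have "v \<in> nbhd r ((+) a ` X) \<longleftrightarrow> v - a \<in> nbhd r X" for v
    using grid_dist_translate[of a _ "v - a"] by (auto simp: nbhd_def)
  moreover have "v \<in> (+) a ` Y \<longleftrightarrow> v - a \<in> Y" for v Y
    by (force simp: image_iff)
  ultimately show ?thesis by blast
qed

lemma core_translate: "core s \<delta> (a + u) = (+) a ` core s (\<lambda>w. \<delta> (a + w)) u"
proof -
  have all: "(\<forall>w. P w) \<longleftrightarrow> (\<forall>w. P (a + w))" for P :: "int ^ 'a \<Rightarrow> bool"
    by (metis add.commute diff_add_cancel)
  have "a + v \<in> core s \<delta> (a + u) \<longleftrightarrow> v \<in> core s (\<lambda>w. \<delta> (a + w)) u" for v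
    unfolding core_def mem_Collect_eq grid_dist_translate
    by (subst all) (simp add: grid_dist_translate)
  from this[of "_ - a"] show ?thesis by (force simp: image_iff)
qed

text \<open>A piece that comes within distance \<open>r\<close> is swallowed together with its own
  \<open>r\<close>-neighbourhood. This collar keeps the boundary of the result away from the
  swallowed piece; an ignored piece is more than \<open>r\<close> away from
  \<open>X\<close>.\<close>

definition absorb :: "nat \<Rightarrow> (int ^ 'd::finite) set set \<Rightarrow> (int ^ 'd) set \<Rightarrow> (int ^ 'd) set" where
  "absorb r \<E> X = X \<union> \<Union>(nbhd r ` {E \<in> \<E>. E \<inter> nbhd r X \<noteq> {}})"

lemma subset_absorb: "X \<subseteq> absorb r \<E> X"
  by (auto simp: absorb_def)

lemma grid_connected_absorb:
  assumes "grid_connected X" "\<And>E. E \<in> \<E> \<Longrightarrow> grid_connected E"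
  shows "grid_connected (absorb r \<E> X)"
  unfolding absorb_def
proof (rule grid_connected_Union[OF assms(1)])
  fix Y assume "Y \<in> nbhd r ` {E \<in> \<E>. E \<inter> nbhd r X \<noteq> {}}"
  then obtain E where E: "Y = nbhd r E" "E \<in> \<E>" "E \<inter> nbhd r X \<noteq> {}" by blast
  then have "X \<inter> Y \<noteq> {}" by (force simp: nbhd_def grid_dist_sym)
  with E assms(2) grid_connected_nbhd show "grid_connected Y \<and> X \<inter> Y \<noteq> {}" by blast
qed

text \<open>From \<open>X\<close> the enlargement goes \<open>r\<close> to reach a piece, at most
  its diameter \<open>t\<close> across, and \<open>r\<close> out again.\<close>

lemma absorb_subset_nbhd:
  assumes "\<And>E e e'. E \<in> \<E> \<Longrightarrow> e \<in> E \<Longrightarrow> e' \<in> E \<Longrightarrow> grid_dist e e' \<le> t"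
  shows "absorb r \<E> X \<subseteq> nbhd (t + 2 * r) X"
proof
  fix v assume "v \<in> absorb r \<E> X"
  then consider "v \<in> X" | E where "E \<in> \<E>" "E \<inter> nbhd r X \<noteq> {}" "v \<in> nbhd r E"
    by (auto simp: absorb_def)
  then show "v \<in> nbhd (t + 2 * r) X"
  proof cases
    case 1
    then show ?thesis using subset_nbhd by blast
  next
    case 2
    then obtain x e e' where x: "x \<in> X" and e: "e \<in> E" "grid_dist x e \<le> r" and e': "e' \<in> E" "grid_dist e' v \<le> r"
      by (auto simp: nbhd_def)
    have "grid_dist e e' \<le> t" using assms 2 e e' by blast
    then have "grid_dist x v \<le> t + 2 * r"
      using e e' grid_dist_triangle[of x v e] grid_dist_triangle[of e v e'] by linarith
    with x show ?thesis by (auto simp: nbhd_def)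
  qed
qed

lemma absorb_translate:
  "absorb r ((`) ((+) a) ` \<E>) ((+) a ` X) = (+) a ` absorb r \<E> X"
proof -
  have "{E \<in> (`) ((+) a) ` \<E>. E \<inter> nbhd r ((+) a ` X) \<noteq> {}} = (`) ((+) a) ` {E \<in> \<E>. E \<inter> nbhd r X \<noteq> {}}"
  proof -
    have iff: "(+) a ` E \<inter> nbhd r ((+) a ` X) \<noteq> {} \<longleftrightarrow> E \<inter> nbhd r X \<noteq> {}" for E
      unfolding image_plus_nbhd by (subst image_Int[symmetric]) auto
    have "{E \<in> f ` A. P E} = f ` {E \<in> A. P (f E)}" for f :: "(int ^ 'a) set \<Rightarrow> (int ^ 'a) set" and A P
      by blast
    from this[of "(`) ((+) a)" \<E> "\<lambda>E. E \<inter> nbhd r ((+) a ` X) \<noteq> {}"] show ?thesis unfolding iff .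
  qed
  then show ?thesis
    unfolding absorb_def image_Un image_Union by (simp add: image_image image_plus_nbhd)
qed

text \<open>At level \<open>i\<close> cores have gap \<open>s i\<close>, weights are at most
  \<open>m i\<close>, pieces are absorbed at range \<open>\<rho> i\<close>, and
  \<open>\<tau> i\<close> bounds how far \<open>engulf\<close> at level \<open>i\<close> enlarges a
  set. \<open>separation\<close> leaves more than \<open>2 * \<rho> i\<close> between enlarged
  cores; \<open>margin\<close> leaves \<open>q\<close> of the collar after the lower levels have
  moved the boundary; \<open>growth\<close> adds up the diameter \<open>2 * (m i + \<tau> i)\<close>
  of a piece, two absorption ranges and the \<open>\<tau> i\<close> spent by the lower
  levels.\<close>

locale toast_scales =
  fixes q :: nat and s m \<rho> \<tau> :: "nat \<Rightarrow> nat"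
  assumes separation: "2 * \<tau> i + 2 * \<rho> i < s i"
    and margin: "\<tau> i + q \<le> \<rho> i"
    and growth: "2 * m i + 3 * \<tau> i + 2 * \<rho> i \<le> \<tau> (Suc i)"
begin

text \<open>\<open>engulf \<delta> j X\<close> absorbs the pieces of the levels \<open>j - 1, \<dots>, 0\<close>, in this order: what the lower
  levels add later stays within the margin that the higher ones have left.\<close>

primrec engulf :: "(nat \<Rightarrow> int ^ 'd::finite \<Rightarrow> nat) \<Rightarrow> nat \<Rightarrow> (int ^ 'd) set \<Rightarrow> (int ^ 'd) set" where
  "engulf \<delta> 0 = (\<lambda>X. X)"
| "engulf \<delta> (Suc i) = (\<lambda>X. engulf \<delta> i (absorb (\<rho> i)
      {engulf \<delta> i (core (s i) (\<delta> i) u) |u. core (s i) (\<delta> i) u \<noteq> {}} X))"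

definition pieces :: "(nat \<Rightarrow> int ^ 'd::finite \<Rightarrow> nat) \<Rightarrow> nat \<Rightarrow> (int ^ 'd) set set" where
  "pieces \<delta> i = {engulf \<delta> i (core (s i) (\<delta> i) u) |u. core (s i) (\<delta> i) u \<noteq> {}}"

lemma engulf_Suc: "engulf \<delta> (Suc i) X = engulf \<delta> i (absorb (\<rho> i) (pieces \<delta> i) X)"
  by (simp add: pieces_def)

lemma q_le_rho: "q \<le> \<rho> i"
  using margin[of i] by simp

lemma tau_mono: "i \<le> j \<Longrightarrow> \<tau> i \<le> \<tau> j"
proof (rule lift_Suc_mono_le[of \<tau>])
  show "\<tau> n \<le> \<tau> (Suc n)" for n using growth[of n] by linarith
qed

lemma subset_engulf: "X \<subseteq> engulf \<delta> j X"
proof (induction j arbitrary: X)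
  case (Suc j)
  show ?case unfolding engulf_Suc using Suc.IH subset_absorb by (rule order_trans[rotated])
qed simp

text \<open>The two claims are proved together: enlarging at level \<open>Suc j\<close> uses the
  pieces of level \<open>j\<close>, which are themselves enlarged cores.\<close>

lemma piece_connected_aux:
  "(grid_connected X \<longrightarrow> grid_connected (engulf \<delta> j X)) \<and> (\<forall>E\<in>pieces \<delta> j. grid_connected E)"
proof (induction j arbitrary: X)
  case 0
  then show ?case by (auto simp: pieces_def intro: grid_connected_core)
next
  case (Suc j)
  have *: "grid_connected (engulf \<delta> (Suc j) X)" if "grid_connected X" for X
  proof -
    have "grid_connected E" if "E \<in> pieces \<delta> j" for E using Suc.IH[of X] that by simp
    then have "grid_connected (absorb (\<rho> j) (pieces \<delta> j) X)"
      using grid_connected_absorb \<open>grid_connected X\<close> by blast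
    then show ?thesis unfolding engulf_Suc using Suc.IH by simp
  qed
  have "grid_connected E" if "E \<in> pieces \<delta> (Suc j)" for E
  proof -
    from that obtain u where "E = engulf \<delta> (Suc j) (core (s (Suc j)) (\<delta> (Suc j)) u)"
      "core (s (Suc j)) (\<delta> (Suc j)) u \<noteq> {}" unfolding pieces_def by blast
    with * grid_connected_core show ?thesis by metis
  qed
  with * show ?case by blast
qed

lemma piece_connected: "E \<in> pieces \<delta> j \<Longrightarrow> grid_connected E"
  using piece_connected_aux by blast

text \<open>Equivariance under translation lets a vertex compute its piece from its own labelled
  ball, as if it were the origin.\<close>

lemma engulf_translate:
  "engulf \<delta> j ((+) a ` X) = (+) a ` engulf (\<lambda>i w. \<delta> i (a + w)) j X"
  "pieces \<delta> j = (`) ((+) a) ` pieces (\<lambda>i w. \<delta> i (a + w)) j"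
proof -
  have pieces: "pieces \<delta> j = (`) ((+) a) ` pieces (\<lambda>i w. \<delta> i (a + w)) j"
    if engulf: "\<And>X. engulf \<delta> j ((+) a ` X) = (+) a ` engulf (\<lambda>i w. \<delta> i (a + w)) j X" for j
  proof -
    have ex: "(\<exists>u. P u) \<longleftrightarrow> (\<exists>u. P (a + u))" for P :: "int ^ 'a \<Rightarrow> bool"
      by (metis add.commute diff_add_cancel)
    have "D \<in> pieces \<delta> j \<longleftrightarrow> D \<in> (`) ((+) a) ` pieces (\<lambda>i w. \<delta> i (a + w)) j" for D
      unfolding pieces_def mem_Collect_eq
      by (subst ex) (auto simp: core_translate engulf)
    then show ?thesis by blast
  qed
  show engulf: "engulf \<delta> j ((+) a ` X) = (+) a ` engulf (\<lambda>i w. \<delta> i (a + w)) j X" for X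
  proof (induction j arbitrary: X)
    case (Suc j)
    show ?case unfolding engulf_Suc pieces[OF Suc.IH] absorb_translate by (rule Suc.IH)
  qed simp
  then show "pieces \<delta> j = (`) ((+) a) ` pieces (\<lambda>i w. \<delta> i (a + w)) j" by (rule pieces)
qed

section \<open>Geometry of the pieces for bounded weights\<close>

context
  fixes \<delta> :: "nat \<Rightarrow> int ^ 'd::finite \<Rightarrow> nat"
  assumes bounded: "\<And>i u. \<delta> i u \<le> m i"
begin

lemma engulf_subset_nbhd: "engulf \<delta> j X \<subseteq> nbhd (\<tau> j) X"
proof (induction j arbitrary: X)
  case 0
  show ?case by (simp add: subset_nbhd)
next
  case (Suc j)
  have diam: "grid_dist e e' \<le> 2 * (m j + \<tau> j)" if "E \<in> pieces \<delta> j" "e \<in> E" "e' \<in> E" for E e e'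
  proof -
    from that obtain u where "E = engulf \<delta> j (core (s j) (\<delta> j) u)" by (auto simp: pieces_def)
    then have "E \<subseteq> nbhd (\<tau> j) (core (s j) (\<delta> j) u)" using Suc.IH by simp
    also have "\<dots> \<subseteq> grid_ball u (m j + \<tau> j)" by (intro nbhd_ball core_subset_ball bounded)
    finally have "grid_dist u e \<le> m j + \<tau> j" "grid_dist u e' \<le> m j + \<tau> j"
      using that by (auto simp: grid_ball_def)
    then show ?thesis using grid_dist_triangle[of e e' u] by (simp add: grid_dist_sym)
  qed
  have "engulf \<delta> (Suc j) X \<subseteq> nbhd (\<tau> j) (absorb (\<rho> j) (pieces \<delta> j) X)"
    unfolding engulf_Suc by (rule Suc.IH)
  also have "\<dots> \<subseteq> nbhd (\<tau> j) (nbhd (2 * (m j + \<tau> j) + 2 * \<rho> j) X)"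
    by (intro nbhd_mono absorb_subset_nbhd diam order_refl)
  also have "\<dots> \<subseteq> nbhd (\<tau> j + (2 * (m j + \<tau> j) + 2 * \<rho> j)) X" by (rule nbhd_nbhd)
  also have "\<dots> \<subseteq> nbhd (\<tau> (Suc j)) X" using growth[of j] by (intro nbhd_mono) auto
  finally show ?case .
qed

lemma piece_diam:
  assumes "E \<in> pieces \<delta> j" "e \<in> E" "e' \<in> E"
  shows "grid_dist e e' \<le> 2 * (m j + \<tau> j)"
proof -
  from assms obtain u where "E = engulf \<delta> j (core (s j) (\<delta> j) u)" by (auto simp: pieces_def)
  then have "E \<subseteq> nbhd (\<tau> j) (core (s j) (\<delta> j) u)" using engulf_subset_nbhd by simp
  also have "\<dots> \<subseteq> grid_ball u (m j + \<tau> j)" by (intro nbhd_ball core_subset_ball bounded)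
  finally have "grid_dist u e \<le> m j + \<tau> j" "grid_dist u e' \<le> m j + \<tau> j"
    using assms by (auto simp: grid_ball_def)
  then show ?thesis using grid_dist_triangle[of e e' u] by (simp add: grid_dist_sym)
qed

lemma piece_subset_ball: "E \<in> pieces \<delta> j \<Longrightarrow> e \<in> E \<Longrightarrow> E \<subseteq> grid_ball e (2 * (m j + \<tau> j))"
  using piece_diam by (auto simp: grid_ball_def)

lemma piece_finite: "E \<in> pieces \<delta> j \<Longrightarrow> finite E"
  using finite_subset[OF piece_subset_ball finite_grid_ball] by (cases "E = {}") auto

lemma pieces_separated:
  assumes "D \<in> pieces \<delta> j" "E \<in> pieces \<delta> j" "D \<noteq> E" "x \<in> D" "y \<in> E"
  shows "2 * \<rho> j < grid_dist x y"
proof -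
  from assms obtain u u' where u: "D = engulf \<delta> j (core (s j) (\<delta> j) u)" "E = engulf \<delta> j (core (s j) (\<delta> j) u')"
    by (auto simp: pieces_def)
  with assms have "u \<noteq> u'" by auto
  from u assms engulf_subset_nbhd have
    "x \<in> nbhd (\<tau> j) (core (s j) (\<delta> j) u)" "y \<in> nbhd (\<tau> j) (core (s j) (\<delta> j) u')" by blast+
  then obtain x' y' where x': "x' \<in> core (s j) (\<delta> j) u" "grid_dist x' x \<le> \<tau> j"
    and y': "y' \<in> core (s j) (\<delta> j) u'" "grid_dist y' y \<le> \<tau> j" by (auto simp: nbhd_def)
  have "s j \<le> grid_dist x' y'" using core_separated x' y' \<open>u \<noteq> u'\<close> by blast
  also have "\<dots> \<le> grid_dist x' x + (grid_dist x y + grid_dist y y')"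
    using grid_dist_triangle[of x' y' x] grid_dist_triangle[of x y' y] by linarith
  finally show ?thesis using x' y' separation[of j] by (simp add: grid_dist_sym)
qed

lemma pieces_disjoint:
  "D \<in> pieces \<delta> j \<Longrightarrow> E \<in> pieces \<delta> j \<Longrightarrow> x \<in> D \<Longrightarrow> x \<in> E \<Longrightarrow> D = E"
  using pieces_separated[of D j E x x] by auto

text \<open>Absorption runs from high to low levels, so the step at level \<open>i\<close> decides
  the fate of \<open>E\<close>: either it is swallowed with its collar, which later steps keep, or
  it remains more than \<open>\<rho> i\<close> away, and the levels below \<open>i\<close> use up at
  most \<open>\<tau> i\<close> of this.\<close>

lemma engulf_dichotomy:
  assumes "E \<in> pieces \<delta> i" "i < j"
  shows "nbhd (\<rho> i) E \<subseteq> engulf \<delta> j X \<or> (\<forall>e\<in>E. \<forall>x\<in>engulf \<delta> j X. q < grid_dist e x)"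
  using \<open>i < j\<close>
proof (induction j arbitrary: X)
  case (Suc j)
  show ?case
  proof (cases "i < j")
    case True
    then show ?thesis unfolding engulf_Suc by (rule Suc.IH)
  next
    case False
    with Suc.prems have [simp]: "j = i" by simp
    let ?Z = "absorb (\<rho> i) (pieces \<delta> i) X"
    show ?thesis
    proof (cases "E \<inter> nbhd (\<rho> i) X = {}")
      case False
      with assms have "nbhd (\<rho> i) E \<subseteq> ?Z" by (auto simp: absorb_def)
      then have "nbhd (\<rho> i) E \<subseteq> engulf \<delta> i ?Z" using subset_engulf[of ?Z \<delta> i] by (rule order_trans)
      then show ?thesis by (simp add: engulf_Suc del: engulf.simps)
    next
      case True
      \<comment> \<open>A swallowed \<open>E'\<close> is more than \<open>2 * \<rho> i\<close> away
        from \<open>E\<close>, so its collar of width \<open>\<rho> i\<close> does not come within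
        \<open>\<rho> i\<close> of \<open>E\<close>.\<close>
      have far: "\<rho> i < grid_dist e z" if "e \<in> E" "z \<in> ?Z" for e z
      proof -
        from \<open>z \<in> ?Z\<close> consider "z \<in> X"
          | E' where "E' \<in> pieces \<delta> i" "E' \<inter> nbhd (\<rho> i) X \<noteq> {}" "z \<in> nbhd (\<rho> i) E'"
          by (auto simp: absorb_def)
        then show ?thesis
        proof cases
          case 1
          then show ?thesis using True that by (force simp: nbhd_def grid_dist_sym not_le)
        next
          case 2
          then have "E' \<noteq> E" using True by blast
          from 2 obtain e' where "e' \<in> E'" "grid_dist e' z \<le> \<rho> i" by (auto simp: nbhd_def)
          moreover from this have "2 * \<rho> i < grid_dist e e'"
            using pieces_separated assms(1) 2 \<open>E' \<noteq> E\<close> that by blast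
          moreover have "grid_dist e e' \<le> grid_dist e z + grid_dist e' z"
            using grid_dist_triangle[of e e' z] by (simp add: grid_dist_sym)
          ultimately show ?thesis by linarith
        qed
      qed
      have "q < grid_dist e x" if "e \<in> E" "x \<in> engulf \<delta> (Suc j) X" for e x
      proof -
        from that have "x \<in> nbhd (\<tau> i) ?Z" using engulf_subset_nbhd[of i ?Z] by (auto simp: engulf_Suc simp del: engulf.simps)
        then obtain z where z: "z \<in> ?Z" "grid_dist z x \<le> \<tau> i" by (auto simp: nbhd_def)
        have "grid_dist e z \<le> grid_dist e x + grid_dist z x"
          using grid_dist_triangle[of e z x] by (simp add: grid_dist_sym)
        with far[OF \<open>e \<in> E\<close> z(1)] z(2) margin[of i] show ?thesis by linarith
      qed
      then show ?thesis by blast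
    qed
  qed
qed simp

lemma piece_dichotomy:
  assumes "E \<in> pieces \<delta> i" "D \<in> pieces \<delta> j" "i < j"
  shows "nbhd (\<rho> i) E \<subseteq> D \<or> (\<forall>e\<in>E. \<forall>x\<in>D. q < grid_dist e x)"
  using engulf_dichotomy[OF assms(1,3)] assms(2) by (auto simp: pieces_def)

text \<open>If \<open>E\<close> lies in \<open>D\<close> with its collar, a neighbour of
  \<open>y\<close> outside \<open>D\<close> is more than \<open>\<rho> i\<close> from
  \<open>x\<close>, so \<open>y\<close> itself is at least \<open>\<rho> i\<close> away. Otherwise
  the pieces are more than \<open>q\<close> apart.\<close>

lemma boundaries_apart_levels:
  assumes "E \<in> pieces \<delta> i" "D \<in> pieces \<delta> j" "i < j" "x \<in> boundary E" "y \<in> boundary D"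
  shows "q \<le> grid_dist x y"
proof (cases "nbhd (\<rho> i) E \<subseteq> D")
  case True
  from assms obtain z where z: "(y, z) \<in> grid_adj" "z \<notin> D" by (auto simp: boundary_def)
  with True assms have "\<rho> i < grid_dist x z" by (force simp: nbhd_def boundary_def not_le)
  also have "\<dots> \<le> grid_dist x y + 1"
    using grid_dist_triangle[of x z y] grid_dist_adj[OF z(1)] by linarith
  finally show ?thesis using q_le_rho[of i] by linarith
next
  case False
  with piece_dichotomy[OF assms(1-3)] assms show ?thesis by (force simp: boundary_def)
qed

lemma pieces_boundary_separated:
  assumes "D \<in> pieces \<delta> i" "E \<in> pieces \<delta> j" "set_dist (boundary D) (boundary E) < enat q"
  shows "D = E"
proof -
  from assms(3) obtain x y where xy: "x \<in> boundary D" "y \<in> boundary E" "grid_dist x y < q"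
    by (auto simp: set_dist_def INF_less_iff)
  consider "i < j" | "j < i" | "i = j" by linarith
  then show ?thesis
  proof cases
    case 1
    from boundaries_apart_levels[OF assms(1,2) 1] xy show ?thesis by force
  next
    case 2
    from boundaries_apart_levels[OF assms(2,1) 2] xy show ?thesis by (force simp: grid_dist_sym)
  next
    case 3
    show ?thesis
    proof (rule ccontr)
      assume "D \<noteq> E"
      with pieces_separated[of D j E x y] assms xy 3 have "2 * \<rho> j < grid_dist x y"
        by (auto simp: boundary_def)
      with xy q_le_rho[of j] show False by linarith
    qed
  qed
qed

lemma is_toast_pieces:
  assumes "\<And>n. \<exists>i u. grid_ball 0 n \<subseteq> core (s i) (\<delta> i) u"
  shows "is_toast q (\<Union>i. pieces \<delta> i)"
  unfolding is_toast_def
proof (intro conjI ballI allI impI)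
  fix g h :: "int ^ 'd"
  define n where "n = max (grid_dist 0 g) (grid_dist 0 h)"
  from assms obtain i u where "grid_ball 0 n \<subseteq> core (s i) (\<delta> i) u" by blast
  moreover have "g \<in> grid_ball 0 n" "h \<in> grid_ball 0 n" by (auto simp: grid_ball_def n_def)
  ultimately have gh: "g \<in> core (s i) (\<delta> i) u" "h \<in> core (s i) (\<delta> i) u" by auto
  let ?D = "engulf \<delta> i (core (s i) (\<delta> i) u)"
  have "?D \<in> pieces \<delta> i" using gh by (auto simp: pieces_def)
  moreover have "g \<in> ?D" "h \<in> ?D" using gh subset_engulf by blast+
  ultimately show "\<exists>D\<in>\<Union>i. pieces \<delta> i. g \<in> D \<and> h \<in> D" by blast
next
  fix D assume "D \<in> (\<Union>i. pieces \<delta> i)"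
  then obtain i where "D \<in> pieces \<delta> i" by blast
  then show "finite D" "grid_connected D" by (rule piece_finite, rule piece_connected)
next
  fix D E assume "D \<in> (\<Union>i. pieces \<delta> i)" "E \<in> (\<Union>i. pieces \<delta> i)" "set_dist (boundary D) (boundary E) < enat q"
  then show "D = E" using pieces_boundary_separated by (elim UN_E)
qed

text \<open>Pieces of the same level that share \<open>v\<close> coincide; against a higher level
  the far alternative of the dichotomy fails at \<open>v\<close>, so \<open>D\<close> is
  swallowed.\<close>

lemma minimal_piece_least_level:
  assumes "D \<in> pieces \<delta> j" "v \<in> D" "\<And>i E. E \<in> pieces \<delta> i \<Longrightarrow> v \<in> E \<Longrightarrow> j \<le> i"
  shows "minimal_piece (\<Union>i. pieces \<delta> i) v D"
  unfolding minimal_piece_def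
proof (intro conjI ballI impI)
  fix E assume "E \<in> (\<Union>i. pieces \<delta> i)" "v \<in> E"
  then obtain i where i: "E \<in> pieces \<delta> i" by blast
  with assms \<open>v \<in> E\<close> have "j \<le> i" by blast
  show "D \<subseteq> E"
  proof (cases "i = j")
    case True
    then show ?thesis using pieces_disjoint assms i \<open>v \<in> E\<close> by blast
  next
    case False
    with \<open>j \<le> i\<close> have "j < i" by simp
    from piece_dichotomy[OF assms(1) i this] assms(2) \<open>v \<in> E\<close>
    have "nbhd (\<rho> j) D \<subseteq> E" by force
    then show ?thesis using subset_nbhd by blast
  qed
qed (use assms in blast)+

end

text \<open>Strong induction on the level: to enlarge the core of \<open>D\<close> one must know the
  lower pieces near it, which by induction depend only on weights slightly further away. The scales
  grow fast enough for these excursions to fit into \<open>\<tau> (Suc j)\<close>.\<close>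

lemma engulf_pieces_local:
  fixes \<delta> \<delta>' :: "nat \<Rightarrow> int ^ 'd::finite \<Rightarrow> nat"
  assumes bounded: "\<And>i u. \<delta> i u \<le> m i" "\<And>i u. \<delta>' i u \<le> m i"
    and eq: "\<And>i u. i \<le> j \<Longrightarrow> u \<in> grid_ball v (n + \<tau> (Suc j)) \<Longrightarrow> \<delta> i u = \<delta>' i u"
    and D: "D \<in> pieces \<delta> j" "D \<subseteq> grid_ball v n"
  shows "D \<in> pieces \<delta>' j"
  using assms
proof (induction j arbitrary: \<delta> \<delta>' n D rule: less_induct)
  case (less j)
  note b = less.prems(1,2) and eq = less.prems(3) and D = less.prems(4,5)
  from D(1) obtain u where D_eq: "D = engulf \<delta> j (core (s j) (\<delta> j) u)" and ne: "core (s j) (\<delta> j) u \<noteq> {}"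
    by (auto simp: pieces_def)
  have "u \<in> D" using center_in_core[OF ne] subset_engulf D_eq by blast
  with D have u: "grid_dist v u \<le> n" by (auto simp: grid_ball_def)
  have core: "core (s j) (\<delta> j) u = core (s j) (\<delta>' j) u"
  proof (rule core_local[where m = "m j"])
    fix w assume "w \<in> grid_ball u (2 * m j)"
    then have "grid_dist v w \<le> n + \<tau> (Suc j)"
      using u grid_dist_triangle[of v w u] growth[of j] by (simp add: grid_ball_def)
    then show "\<delta> j w = \<delta>' j w" using eq by (simp add: grid_ball_def)
  qed (use b in auto)
  \<comment> \<open>Whatever is absorbed stays inside the result, hence in the ball, so at every
    stage only pieces near the ball are consulted.\<close>
  have engulf: "engulf \<delta> k X = engulf \<delta>' k X" if "k \<le> j" "engulf \<delta> k X \<subseteq> grid_ball v n" for k X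
    using that
  proof (induction k arbitrary: X)
    case (Suc k)
    let ?Z = "absorb (\<rho> k) (pieces \<delta> k) X"
    from Suc.prems have kj: "k < j" by simp
    have Z: "engulf \<delta> k ?Z \<subseteq> grid_ball v n" using Suc.prems unfolding engulf_Suc by blast
    then have X: "X \<subseteq> grid_ball v n" using subset_engulf[of ?Z \<delta> k] subset_absorb[of X] by blast
    \<comment> \<open>Diameter of a piece of level \<open>k\<close> and absorption range, plus the
      distance that the induction hypothesis asks for.\<close>
    have radius: "2 * (m k + \<tau> k) + \<rho> k + \<tau> (Suc k) \<le> \<tau> (Suc j)"
    proof -
      have "3 * \<tau> (Suc k) \<le> \<tau> (Suc (Suc k))" using growth[of "Suc k"] by linarith
      moreover have "\<tau> (Suc (Suc k)) \<le> \<tau> (Suc j)" using kj by (intro tau_mono) simp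
      moreover have "2 * (m k + \<tau> k) + \<rho> k \<le> \<tau> (Suc k)" using growth[of k] by simp
      ultimately show ?thesis by simp
    qed
    have sub: "{E \<in> pieces \<delta>1 k. E \<inter> nbhd (\<rho> k) X \<noteq> {}} \<subseteq> pieces \<delta>2 k"
      if b: "\<And>i u. \<delta>1 i u \<le> m i" "\<And>i u. \<delta>2 i u \<le> m i"
        and eq: "\<And>i u. i \<le> j \<Longrightarrow> u \<in> grid_ball v (n + \<tau> (Suc j)) \<Longrightarrow> \<delta>1 i u = \<delta>2 i u" for \<delta>1 \<delta>2 :: "nat \<Rightarrow> int ^ 'd \<Rightarrow> nat"
    proof
      fix E assume "E \<in> {E \<in> pieces \<delta>1 k. E \<inter> nbhd (\<rho> k) X \<noteq> {}}"
      then obtain e x where E: "E \<in> pieces \<delta>1 k" and e: "e \<in> E" "x \<in> X" "grid_dist x e \<le> \<rho> k"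
        by (auto simp: nbhd_def)
      let ?n = "n + \<rho> k + 2 * (m k + \<tau> k)"
      have ve: "grid_dist v e \<le> n + \<rho> k"
        using X e grid_dist_triangle[of v e x] by (fastforce simp: grid_ball_def)
      have sub: "E \<subseteq> grid_ball v ?n"
      proof
        fix y assume "y \<in> E"
        with piece_diam[OF b(1) E e(1)] have "grid_dist e y \<le> 2 * (m k + \<tau> k)" by simp
        with ve show "y \<in> grid_ball v ?n" using grid_dist_triangle[of v y e] by (simp add: grid_ball_def)
      qed
      have eqk: "\<delta>1 i u = \<delta>2 i u" if "i \<le> k" "u \<in> grid_ball v (?n + \<tau> (Suc k))" for i u
        using eq[of i u] that kj radius by (simp add: grid_ball_def)
      show "E \<in> pieces \<delta>2 k"
        by (rule less.IH[OF kj b(1) b(2) eqk E sub])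
    qed
    have "{E \<in> pieces \<delta> k. E \<inter> nbhd (\<rho> k) X \<noteq> {}} = {E \<in> pieces \<delta>' k. E \<inter> nbhd (\<rho> k) X \<noteq> {}}"
      using sub[of \<delta> \<delta>'] sub[of \<delta>' \<delta>] b eq by auto
    then have "absorb (\<rho> k) (pieces \<delta>' k) X = ?Z" by (simp add: absorb_def)
    then show ?case using Suc.IH[OF _ Z] kj unfolding engulf_Suc by simp
  qed simp
  have "D = engulf \<delta>' j (core (s j) (\<delta>' j) u)"
    using engulf[of j "core (s j) (\<delta> j) u"] D(2) by (simp add: D_eq core)
  with ne core show ?case unfolding pieces_def by blast
qed

end

section \<open>Counting the weights without a clear winner\<close>

text \<open>Failure of \<open>v\<close> to lie in a core, with the contest restricted to
  \<open>V\<close>, so that configurations on a finite \<open>V\<close> can be counted.\<close>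

definition no_winner :: "nat \<Rightarrow> (int ^ 'd::finite) set \<Rightarrow> int ^ 'd \<Rightarrow> (int ^ 'd \<Rightarrow> nat) \<Rightarrow> bool" where
  "no_winner s V v \<delta> \<longleftrightarrow> \<not> (\<exists>u\<in>V. grid_dist u v + s \<le> \<delta> u \<and>
     (\<forall>w\<in>V - {u}. \<delta> w + grid_dist u v + s \<le> \<delta> u + grid_dist w v))"

lemma no_winner_cong: "(\<And>u. u \<in> V \<Longrightarrow> \<delta> u = \<delta>' u) \<Longrightarrow> no_winner s V v \<delta> = no_winner s V v \<delta>'"
  unfolding no_winner_def by (intro arg_cong[where f = Not] bex_cong conj_cong ball_cong) auto

text \<open>Contestants outside \<open>V\<close> are further from \<open>v\<close> than the largest
  weight, so their scores are negative.\<close>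

lemma winner_core:
  assumes "\<not> no_winner s V v \<delta>" "\<And>w. \<delta> w \<le> m" "grid_ball v m \<subseteq> V"
  shows "\<exists>u. v \<in> core s \<delta> u"
proof -
  from assms(1) obtain u where u: "u \<in> V" "grid_dist u v + s \<le> \<delta> u"
    "\<And>w. w \<in> V \<Longrightarrow> w \<noteq> u \<Longrightarrow> \<delta> w + grid_dist u v + s \<le> \<delta> u + grid_dist w v"
    unfolding no_winner_def by auto
  have "\<delta> w + grid_dist u v + s \<le> \<delta> u + grid_dist w v" if "w \<noteq> u" for w
  proof (cases "w \<in> V")
    case True
    then show ?thesis using u that by blast
  next
    case False
    with assms(3) have "w \<notin> grid_ball v m" by blast
    then have "m < grid_dist v w" by (simp add: grid_ball_def)
    then have "m < grid_dist w v" by (simp add: grid_dist_sym)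
    then show ?thesis using u(2) assms(2)[of w] by linarith
  qed
  with u show ?thesis by (auto simp: core_def)
qed

lemma card_fiberwise_le:
  assumes "finite Q" "finite F" "u \<in> V"
    and A: "A \<subseteq> PiE V (\<lambda>_. F)" "\<And>y. y \<in> A \<Longrightarrow> restrict y (V - {u}) \<in> Q"
    and k: "\<And>z. z \<in> Q \<Longrightarrow> card {t \<in> F. z(u := t) \<in> A} \<le> k"
  shows "card A \<le> card Q * k"
proof -
  let ?S = "SIGMA z:Q. {t \<in> F. z(u := t) \<in> A}"
  have "A \<subseteq> (\<lambda>(z, t). z(u := t)) ` ?S"
  proof
    fix y assume y: "y \<in> A"
    have eq: "(restrict y (V - {u}))(u := y u) = y"
      using A(1) y \<open>u \<in> V\<close> by (auto simp: fun_eq_iff PiE_def extensional_def)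
    have "(restrict y (V - {u}), y u) \<in> ?S" using A y eq \<open>u \<in> V\<close> by (auto simp: PiE_iff)
    then show "y \<in> (\<lambda>(z, t). z(u := t)) ` ?S" using eq by (intro image_eqI[where x = "(restrict y (V - {u}), y u)"]) simp_all
  qed
  then have "card A \<le> card ?S"
    using assms(1,2) by (intro surj_card_le) auto
  also have "\<dots> = (\<Sum>z\<in>Q. card {t \<in> F. z(u := t) \<in> A})" using assms(1,2) by simp
  also have "\<dots> \<le> (\<Sum>z\<in>Q. k)" by (intro sum_mono k)
  finally show ?thesis by simp
qed

lemma card_window_le:
  fixes W :: "nat set"
  assumes "\<And>x y. x \<in> W \<Longrightarrow> y \<in> W \<Longrightarrow> y < x + s"
  shows "finite W" "card W \<le> s"
proof -
  have "W \<subseteq> {(LEAST x. x \<in> W)..<(LEAST x. x \<in> W) + s}"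
  proof
    fix y assume y: "y \<in> W"
    then have "(LEAST x. x \<in> W) \<in> W" by (rule LeastI)
    from assms[OF this y] y show "y \<in> {(LEAST x. x \<in> W)..<(LEAST x. x \<in> W) + s}"
      by (auto intro: Least_le)
  qed
  then show "finite W" "card W \<le> s"
    using finite_subset card_mono[of "{(LEAST x. x \<in> W)..<(LEAST x. x \<in> W) + s}" W] by auto
qed

text \<open>A vertex draws a symbol \<open>y < N\<close> uniformly and has weight \<open>g y\<close>. The bounds \<open>many\<close> and \<open>few\<close> say
  that the mean number of vertices of type \<open>a\<close> in a ball of radius of the order of \<open>h a\<close> is of
  constant order; the 3 is there because \<open>exp 3 \<ge> 8\<close>.\<close>

locale weight_law =
  fixes s n N :: nat and h \<kappa> :: "nat \<Rightarrow> nat" and g :: "nat \<Rightarrow> nat" and C :: real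
    and v :: "int ^ 'd::finite"
  assumes s_pos: "0 < s" and N_pos: "0 < N" and h_0: "4 * s \<le> h 0" and h_Suc: "h (Suc a) = 4 * h a"
    and g_range: "y < N \<Longrightarrow> g y \<noteq> 0 \<Longrightarrow> \<exists>a\<le>n. g y \<in> {h a..<2 * h a}"
    and g_card: "a \<le> n \<Longrightarrow> t \<in> {h a..<2 * h a} \<Longrightarrow> card {y\<in>{..<N}. g y = t} = \<kappa> a"
    and many: "b \<le> n \<Longrightarrow> 3 * N \<le> \<kappa> b * h b * (card (grid_ball v (h b div 2)) - 1)"
    and few: "a \<le> n \<Longrightarrow> real (\<kappa> a * h a * card (grid_ball v (2 * h a))) \<le> C * N"
begin

section \<open>Types of weights and configurations that avoid them\<close>

lemma h_mono: "a \<le> b \<Longrightarrow> h a \<le> h b"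
  by (rule lift_Suc_mono_le[of h]) (simp_all add: h_Suc)

lemma h_less: "a < b \<Longrightarrow> 4 * h a \<le> h b"
  using h_mono[of "Suc a" b] by (simp add: h_Suc)

lemma h_ge: "4 * s \<le> h a"
  using h_mono[of 0 a] h_0 by simp

lemma h_pos: "0 < h a"
  using h_ge[of a] s_pos by simp

lemma h_eq: "a \<le> b \<Longrightarrow> h b = 4 ^ (b - a) * h a"
  by (induction b rule: dec_induct) (simp_all add: h_Suc Suc_diff_le)

definition "type_set a = {h a..<2 * h a}"

lemma type_disjoint: "a \<noteq> b \<Longrightarrow> type_set a \<inter> type_set b = {}"
  using h_less[of a b] h_less[of b a] by (cases "a < b") (auto simp: type_set_def)

lemma card_type: 
  assumes "a \<le> n"
  shows "card {y\<in>{..<N}. g y \<in> type_set a} = \<kappa> a * h a"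
proof -
  have "{y\<in>{..<N}. g y \<in> type_set a} = (\<Union>t\<in>type_set a. {y\<in>{..<N}. g y = t})" by auto
  also have "card \<dots> = (\<Sum>t\<in>type_set a. card {y\<in>{..<N}. g y = t})"
    by (rule card_UN_disjoint) (auto simp: type_set_def)
  also have "\<dots> = (\<Sum>t\<in>type_set a. \<kappa> a)"
    using assms by (intro sum.cong refl g_card) (auto simp: type_set_def)
  finally show ?thesis by (simp add: type_set_def)
qed

text \<open>The types are disjoint, so the count is exactly \<open>N\<close> minus a sum; then
  \<open>1 - x \<le> exp (- x)\<close> gives a form that multiplies well over vertices.\<close>

lemma card_avoid_types:
  assumes "T \<subseteq> {..n}"
  shows "real (card {y\<in>{..<N}. \<forall>b\<in>T. g y \<notin> type_set b}) \<le> N * exp (- (\<Sum>b\<in>T. \<kappa> b * h b / N))"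
proof -
  have fin: "finite T" using assms finite_subset by blast
  let ?U = "\<Union>b\<in>T. {y\<in>{..<N}. g y \<in> type_set b}"
  have "{y\<in>{..<N}. \<forall>b\<in>T. g y \<notin> type_set b} = {..<N} - ?U" by auto
  moreover have "card ({..<N} - ?U) = N - card ?U" using fin by (subst card_Diff_subset) auto
  moreover have "card ?U \<le> N" using card_mono[of "{..<N}" ?U] by auto
  moreover have "card ?U = (\<Sum>b\<in>T. card {y\<in>{..<N}. g y \<in> type_set b})"
    using type_disjoint fin by (intro card_UN_disjoint) fastforce+
  moreover have "\<dots> = (\<Sum>b\<in>T. \<kappa> b * h b)" using assms by (intro sum.cong refl card_type) auto
  ultimately have "real (card {y\<in>{..<N}. \<forall>b\<in>T. g y \<notin> type_set b}) = N - (\<Sum>b\<in>T. real (\<kappa> b * h b))"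
    by (simp add: of_nat_diff)
  also have "\<dots> = N * (1 - (\<Sum>b\<in>T. real (\<kappa> b * h b) / N))"
    using N_pos by (simp add: right_diff_distrib sum_divide_distrib[symmetric])
  also have "\<dots> \<le> N * exp (- (\<Sum>b\<in>T. \<kappa> b * h b / N))"
    using exp_ge_add_one_self[of "- (\<Sum>b\<in>T. real (\<kappa> b * h b) / N)"] by (intro mult_left_mono) auto
  finally show ?thesis .
qed

text \<open>At distance at most \<open>h b div 2\<close> a vertex of type \<open>b\<close> scores at
  least \<open>h b / 2\<close>, more than any weight of a smaller type. So these are the
  configurations without such a dominating vertex of a type in \<open>T\<close>.\<close>

definition avoiding :: "nat set \<Rightarrow> (int ^ 'd) set \<Rightarrow> (int ^ 'd \<Rightarrow> nat) set" where
  "avoiding T W = {y \<in> PiE W (\<lambda>_. {..<N}). \<forall>w\<in>W. \<forall>b\<in>T. grid_dist w v \<le> h b div 2 \<longrightarrow> g (y w) \<notin> type_set b}"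

lemma finite_avoiding: "finite W \<Longrightarrow> finite (avoiding T W)"
  unfolding avoiding_def by (rule finite_subset[of _ "PiE W (\<lambda>_. {..<N})"]) (auto intro!: finite_PiE)

lemma exp_minus_3_le: "exp (- 3 * real k) \<le> 1 / 8 ^ k"
proof -
  have "(2 :: real) ^ 3 \<le> exp 1 ^ 3" using exp_ge_add_one_self[of 1] by (intro power_mono) auto
  then have "(8 :: real) \<le> exp 3" by (simp add: exp_of_nat_mult[symmetric])
  then have "8 ^ k \<le> exp (3 :: real) ^ k" by (intro power_mono) auto
  also have "\<dots> = exp (3 * real k)" by (simp add: exp_of_nat_mult[symmetric] mult.commute)
  finally show ?thesis by (simp add: exp_minus field_simps)
qed

text \<open>The factors over \<open>w\<close> combine to the exponential of a double sum; after
  exchanging the sums, \<open>many\<close> gives each type a contribution of at least 3. The vertex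
  \<open>u\<close> may be missing from \<open>W\<close>, which is why \<open>many\<close> counts one
  vertex less than the ball.\<close>

lemma card_avoiding:
  assumes T: "T \<subseteq> {..n}" and W: "finite W" "\<And>b. b \<in> T \<Longrightarrow> grid_ball v (h b div 2) \<subseteq> insert u W"
  shows "real (card (avoiding T W)) \<le> real N ^ card W / 8 ^ card T"
proof -
  have fin: "finite T" using T finite_subset by blast
  let ?p = "\<lambda>b. real (\<kappa> b * h b) / N"
  let ?T = "\<lambda>w. {b \<in> T. grid_dist w v \<le> h b div 2}"
  have "avoiding T W = PiE W (\<lambda>w. {y\<in>{..<N}. \<forall>b\<in>?T w. g y \<notin> type_set b})"
    by (auto simp: avoiding_def PiE_iff extensional_def)
  then have "card (avoiding T W) = (\<Prod>w\<in>W. card {y\<in>{..<N}. \<forall>b\<in>?T w. g y \<notin> type_set b})"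
    using W by (simp add: card_PiE)
  then have "real (card (avoiding T W)) = (\<Prod>w\<in>W. real (card {y\<in>{..<N}. \<forall>b\<in>?T w. g y \<notin> type_set b}))"
    by simp
  also have "\<dots> \<le> (\<Prod>w\<in>W. N * exp (- (\<Sum>b\<in>?T w. ?p b)))"
    using T by (intro prod_mono conjI card_avoid_types) auto
  also have "\<dots> = real N ^ card W * exp (\<Sum>w\<in>W. - (\<Sum>b\<in>?T w. ?p b))"
    using W by (simp add: prod.distrib exp_sum)
  also have "(\<Sum>w\<in>W. - (\<Sum>b\<in>?T w. ?p b)) = - (\<Sum>w\<in>W. \<Sum>b\<in>T. if grid_dist w v \<le> h b div 2 then ?p b else 0)"
    unfolding sum_negf using fin by (subst sum.inter_filter) (simp_all del: of_nat_mult)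
  also have "\<dots> = - (\<Sum>b\<in>T. \<Sum>w\<in>W. if grid_dist w v \<le> h b div 2 then ?p b else 0)"
    by (subst sum.swap) simp
  also have "real N ^ card W * exp \<dots> \<le> real N ^ card W * exp (- (\<Sum>b\<in>T. 3))"
  proof (intro mult_left_mono, subst exp_le_cancel_iff, subst neg_le_iff_le, rule sum_mono)
    fix b assume b: "b \<in> T"
    let ?B = "{w \<in> W. grid_dist w v \<le> h b div 2}"
    have "grid_ball v (h b div 2) \<subseteq> insert u ?B"
      using W(2)[OF b] by (auto simp: grid_ball_def grid_dist_sym)
    then have "card (grid_ball v (h b div 2)) \<le> card (insert u ?B)" using W(1) by (intro card_mono) auto
    also have "\<dots> \<le> Suc (card ?B)" using W(1) by (simp add: card_insert_if)
    finally have "card (grid_ball v (h b div 2)) - 1 \<le> card ?B" by simp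
    then have "\<kappa> b * h b * (card (grid_ball v (h b div 2)) - 1) \<le> \<kappa> b * h b * card ?B"
      by (rule mult_le_mono2)
    then have "3 * N \<le> \<kappa> b * h b * card ?B"
      by (rule order_trans[rotated]) (use many[of b] T b in blast)
    then have "real (3 * N) \<le> real (\<kappa> b * h b * card ?B)" by (rule of_nat_mono)
    then have "3 * real N \<le> real (\<kappa> b * h b) * real (card ?B)" by simp
    then have "3 \<le> ?p b * card ?B" using N_pos by (simp add: field_simps)
    also have "\<dots> = (\<Sum>w\<in>W. if grid_dist w v \<le> h b div 2 then ?p b else 0)"
      using W(1) by (simp add: sum.inter_filter[symmetric])
    finally show "3 \<le> (\<Sum>w\<in>W. if grid_dist w v \<le> h b div 2 then ?p b else 0)" .
  qed auto
  also have "\<dots> = real N ^ card W * exp (- 3 * real (card T))" by simp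
  also have "\<dots> \<le> real N ^ card W * (1 / 8 ^ card T)"
    by (intro mult_left_mono exp_minus_3_le) auto
  finally show ?thesis by simp
qed

text \<open>The weights for which \<open>u\<close> of type \<open>a\<close> wins at \<open>v\<close>, but not clearly.\<close>

definition narrow :: "(int ^ 'd) set \<Rightarrow> int ^ 'd \<Rightarrow> nat \<Rightarrow> (int ^ 'd \<Rightarrow> nat) set" where
  "narrow V u a = {y \<in> PiE V (\<lambda>_. {..<N}). g (y u) \<in> type_set a \<and>
     restrict y (V - {u}) \<in> avoiding {a<..n} (V - {u}) \<and>
     (\<forall>w\<in>V - {u}. g (y w) + grid_dist u v \<le> g (y u) + grid_dist w v) \<and>
     (\<exists>w\<in>V - {u}. g (y u) + grid_dist w v < g (y w) + grid_dist u v + s)}"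

text \<open>The values off \<open>u\<close> avoid the types above \<open>a\<close>. With these
  fixed, the weights with which \<open>u\<close> wins narrowly lie in a window of length
  \<open>s\<close>, and each of them comes from \<open>\<kappa> a\<close> symbols.\<close>

lemma card_narrow:
  assumes "finite V" "u \<in> V" "grid_ball v (h n) \<subseteq> V" "a \<le> n"
  shows "real (card (narrow V u a)) \<le> real N ^ (card V - 1) / 8 ^ (n - a) * (\<kappa> a * s)"
proof -
  let ?Q = "avoiding {a<..n} (V - {u})"
  have "card (narrow V u a) \<le> card ?Q * (\<kappa> a * s)"
  proof (rule card_fiberwise_le[of _ "{..<N}" u V])
    show "narrow V u a \<subseteq> PiE V (\<lambda>_. {..<N})" by (auto simp: narrow_def)
    show "restrict y (V - {u}) \<in> ?Q" if "y \<in> narrow V u a" for y using that by (auto simp: narrow_def)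
    fix z assume "z \<in> ?Q"
    let ?S = "{t \<in> {..<N}. z(u := t) \<in> narrow V u a}"
    \<comment> \<open>The rival that comes within \<open>s\<close> of \<open>u\<close> under
      \<open>t'\<close> has the same score under \<open>t\<close>, where it does not beat
      \<open>u\<close>.\<close>
    have window: "g t' < g t + s" if tt: "t \<in> ?S" "t' \<in> ?S" for t t'
    proof -
      from tt(2) obtain w where w: "w \<in> V" "w \<noteq> u" "g t' + grid_dist w v < g (z w) + grid_dist u v + s"
        by (auto simp: narrow_def)
      moreover have "g (z w) + grid_dist u v \<le> g t + grid_dist w v"
        using tt(1) w by (auto simp: narrow_def dest!: bspec[of _ _ w])
      ultimately show ?thesis by linarith
    qed
    have W: "finite (g ` ?S)" "card (g ` ?S) \<le> s"
      using card_window_le[of "g ` ?S" s] window by blast+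
    have type: "t \<in> type_set a" if "t \<in> g ` ?S" for t using that by (auto simp: narrow_def)
    have "?S \<subseteq> (\<Union>t\<in>g ` ?S. {y\<in>{..<N}. g y = t})" by auto
    then have "card ?S \<le> card (\<Union>t\<in>g ` ?S. {y\<in>{..<N}. g y = t})" using W by (intro card_mono) auto
    also have "\<dots> \<le> (\<Sum>t\<in>g ` ?S. card {y\<in>{..<N}. g y = t})" by (rule card_UN_le[OF W(1)])
    also have "\<dots> = (\<Sum>t\<in>g ` ?S. \<kappa> a)"
      using type assms(4) by (intro sum.cong refl g_card) (auto simp: type_set_def)
    also have "\<dots> \<le> \<kappa> a * s" using W(2) by (simp add: mult.commute)
    finally show "card ?S \<le> \<kappa> a * s" .
  qed (use assms finite_avoiding in auto)
  then have "real (card (narrow V u a)) \<le> real (card ?Q * (\<kappa> a * s))" by (rule of_nat_mono)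
  then have "real (card (narrow V u a)) \<le> real (card ?Q) * (\<kappa> a * s)" by simp
  also have "real (card ?Q) \<le> real N ^ card (V - {u}) / 8 ^ card {a<..n}"
  proof (rule card_avoiding)
    fix b assume "b \<in> {a<..n}"
    then have "h b div 2 \<le> h n" using h_mono[of b n] by simp
    then have "grid_ball v (h b div 2) \<subseteq> grid_ball v (h n)" by (auto simp: grid_ball_def)
    with assms show "grid_ball v (h b div 2) \<subseteq> insert u (V - {u})" by blast
  qed (use assms in auto)
  also have "card (V - {u}) = card V - 1" using assms by simp
  finally show ?thesis by (simp add: mult_right_mono)
qed

text \<open>Take a vertex \<open>u\<close> of maximal score at \<open>v\<close>. If this score is
  below \<open>s\<close>, no vertex of any type is near \<open>v\<close>. Otherwise \<open>u\<close>
  has some type \<open>a\<close>; a vertex of larger type near \<open>v\<close> would score higher,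
  and without a clear winner some rival is within \<open>s\<close>.\<close>

lemma no_winner_cover:
  assumes V: "finite V" "grid_ball v (2 * h n) \<subseteq> V"
  shows "{y \<in> PiE V (\<lambda>_. {..<N}). no_winner s V v (\<lambda>u. g (y u))} \<subseteq>
    avoiding {..n} V \<union> (\<Union>a\<in>{..n}. \<Union>u\<in>grid_ball v (2 * h a). narrow V u a)"
proof
  fix y assume "y \<in> {y \<in> PiE V (\<lambda>_. {..<N}). no_winner s V v (\<lambda>u. g (y u))}"
  then have y: "y \<in> PiE V (\<lambda>_. {..<N})" and nw: "no_winner s V v (\<lambda>u. g (y u))" by auto
  have yN: "y w < N" if "w \<in> V" for w using y that by (auto simp: PiE_iff)
  let ?f = "\<lambda>u. int (g (y u)) - int (grid_dist u v)"
  have vV: "v \<in> V" using V by (auto simp: grid_ball_def)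
  have "Max (?f ` V) \<in> ?f ` V" using V vV by (intro Max_in) auto
  then obtain u where u: "u \<in> V" "?f u = Max (?f ` V)" by force
  have max: "?f w \<le> ?f u" if "w \<in> V" for w unfolding u(2) using V that by (intro Max_ge) auto
  show "y \<in> avoiding {..n} V \<union> (\<Union>a\<in>{..n}. \<Union>u\<in>grid_ball v (2 * h a). narrow V u a)"
  proof (cases "?f u < int s")
    case True
    have "g (y w) \<notin> type_set b" if "w \<in> V" "grid_dist w v \<le> h b div 2" for w b
    proof
      assume "g (y w) \<in> type_set b"
      then have "int (h b) \<le> g (y w)" by (simp add: type_set_def)
      with max[OF that(1)] True that(2) h_ge[of b] s_pos show False by linarith
    qed
    then have "y \<in> avoiding {..n} V" using y by (auto simp: avoiding_def)
    then show ?thesis by blast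
  next
    case False
    then have gu: "grid_dist u v + s \<le> g (y u)" by simp
    with s_pos g_range[OF yN[OF u(1)]] obtain a where a: "a \<le> n" "g (y u) \<in> type_set a"
      by (auto simp: type_set_def)
    have "u \<in> grid_ball v (2 * h a)" using a gu by (auto simp: grid_ball_def type_set_def grid_dist_sym)
    moreover have "y \<in> narrow V u a"
      unfolding narrow_def mem_Collect_eq
    proof (intro conjI y a ballI)
      show "\<exists>w\<in>V - {u}. g (y u) + grid_dist w v < g (y w) + grid_dist u v + s"
        using nw u(1) gu unfolding no_winner_def by (auto simp: not_le)
      fix w assume w: "w \<in> V - {u}"
      then show "g (y w) + grid_dist u v \<le> g (y u) + grid_dist w v" using max[of w] by simp
    next
      have "g (y w) \<notin> type_set b" if "w \<in> V" "b \<in> {a<..n}" "grid_dist w v \<le> h b div 2" for w b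
      proof
        assume "g (y w) \<in> type_set b"
        then have "int (h b) \<le> g (y w)" by (simp add: type_set_def)
        moreover have "4 * h a \<le> h b" "g (y u) < 2 * h a"
          using that h_less a by (auto simp: type_set_def)
        ultimately show False using max[OF that(1)] that(3) by linarith
      qed
      then show "restrict y (V - {u}) \<in> avoiding {a<..n} (V - {u})"
        using y by (auto simp: avoiding_def PiE_iff)
    qed
    ultimately show ?thesis using a by blast
  qed
qed

text \<open>Union bound over the cover. By \<open>few\<close>, summing over the centres of type
  \<open>a\<close> gives order \<open>s / h a\<close>, times 1/8 for each larger type; as
  \<open>h n / h a\<close> is only a factor 4 per type, the sum over \<open>a\<close> is
  geometric.\<close>

lemma card_no_winner:
  assumes V: "finite V" "grid_ball v (2 * h n) \<subseteq> V"
  shows "real (card {y \<in> PiE V (\<lambda>_. {..<N}). no_winner s V v (\<lambda>u. g (y u))})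
    \<le> real N ^ card V * (1 / 8 ^ Suc n + 2 * C * s / h n)"
proof -
  have vV: "v \<in> V" using V by (auto simp: grid_ball_def)
  have ball_V: "grid_ball v r \<subseteq> V" if "r \<le> 2 * h n" for r using V that by (auto simp: grid_ball_def)
  have card_V: "real N ^ card V = real N ^ (card V - 1) * N"
    using vV V by (cases "card V") auto
  have fin: "finite (narrow V u a)" for u a
    unfolding narrow_def using V by (auto intro!: finite_PiE)
  let ?A = "{y \<in> PiE V (\<lambda>_. {..<N}). no_winner s V v (\<lambda>u. g (y u))}"
  let ?B = "\<Union>a\<in>{..n}. \<Union>u\<in>grid_ball v (2 * h a). narrow V u a"
  have "card ?A \<le> card (avoiding {..n} V \<union> ?B)"
    using no_winner_cover[OF V] V fin finite_avoiding by (intro card_mono) auto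
  also have "\<dots> \<le> card (avoiding {..n} V) + card ?B" by (rule card_Un_le)
  also have "card ?B \<le> (\<Sum>a\<in>{..n}. card (\<Union>u\<in>grid_ball v (2 * h a). narrow V u a))"
    by (rule card_UN_le) simp
  also have "\<dots> \<le> (\<Sum>a\<in>{..n}. \<Sum>u\<in>grid_ball v (2 * h a). card (narrow V u a))"
    by (intro sum_mono card_UN_le) simp
  finally have "real (card ?A) \<le> real (card (avoiding {..n} V)) +
      (\<Sum>a\<in>{..n}. \<Sum>u\<in>grid_ball v (2 * h a). real (card (narrow V u a)))"
    unfolding of_nat_sum[symmetric] of_nat_add[symmetric] of_nat_le_iff by simp
  also have "real (card (avoiding {..n} V)) \<le> real N ^ card V / 8 ^ card {..n}"
  proof (rule card_avoiding[where u = v])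
    fix b assume "b \<in> {..n}"
    then have "h b div 2 \<le> 2 * h n" using h_mono[of b n] by simp
    then show "grid_ball v (h b div 2) \<subseteq> insert v V" using ball_V by blast
  qed (use V in auto)
  also have "(\<Sum>a\<in>{..n}. \<Sum>u\<in>grid_ball v (2 * h a). real (card (narrow V u a)))
      \<le> (\<Sum>a\<in>{..n}. real N ^ card V * (C * s / h n) * (1 / 2) ^ (n - a))"
  proof (rule sum_mono)
    fix a assume "a \<in> {..n}"
    then have a: "a \<le> n" by simp
    have "(\<Sum>u\<in>grid_ball v (2 * h a). real (card (narrow V u a)))
        \<le> (\<Sum>u\<in>grid_ball v (2 * h a). real N ^ (card V - 1) / 8 ^ (n - a) * (\<kappa> a * s))"
    proof (intro sum_mono card_narrow V a)
      fix u assume "u \<in> grid_ball v (2 * h a)"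
      then show "u \<in> V" using ball_V[of "2 * h a"] h_mono[OF a] by auto
    qed (use ball_V in auto)
    also have "\<dots> = real N ^ (card V - 1) / 8 ^ (n - a) * s * (card (grid_ball v (2 * h a)) * \<kappa> a)"
      by simp
    also have "\<dots> \<le> real N ^ (card V - 1) / 8 ^ (n - a) * s * (C * N / h a)"
      using few[OF a] h_pos[of a] by (intro mult_left_mono) (simp_all add: field_simps)
    also have "\<dots> = real N ^ card V * (C * s / h n) * (1 / 2) ^ (n - a)"
    proof -
      \<comment> \<open>Of each factor 8, a 4 turns \<open>h a\<close> into \<open>h n\<close> and a
        2 remains for the geometric series.\<close>
      have "(8 :: real) ^ (n - a) = 4 ^ (n - a) * 2 ^ (n - a)" by (simp add: power_mult_distrib[symmetric])
      then show ?thesis using h_pos[of a] by (simp add: h_eq[OF a] card_V power_divide field_simps)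
    qed
    finally show "(\<Sum>u\<in>grid_ball v (2 * h a). real (card (narrow V u a)))
        \<le> real N ^ card V * (C * s / h n) * (1 / 2) ^ (n - a)" .
  qed
  also have "\<dots> = real N ^ card V * (C * s / h n) * (\<Sum>a\<le>n. (1 / 2) ^ (n - a))"
    by (simp add: sum_distrib_left)
  also have "(\<Sum>a\<le>n. (1 / 2 :: real) ^ (n - a)) = (\<Sum>a\<le>n. (1 / 2) ^ a)"
    by (rule sum.reindex_bij_witness[of _ "\<lambda>a. n - a" "\<lambda>a. n - a"]) auto
  also have "real N ^ card V * (C * s / h n) * \<dots> \<le> real N ^ card V * (C * s / h n) * 2"
  proof (intro mult_left_mono)
    show "(\<Sum>a\<le>n. (1 / 2 :: real) ^ a) \<le> 2"
      by (subst sum_gp0) (simp add: field_simps)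
    have "0 \<le> C * N" using few[of 0] by (rule order_trans[rotated]) simp_all
    then have "0 \<le> C" using N_pos by (simp add: zero_le_mult_iff)
    then show "0 \<le> real N ^ card V * (C * s / h n)" by simp
  qed
  finally show ?thesis by (simp add: algebra_simps)
qed

end

section \<open>Independent digits of a uniform label\<close>

text \<open>Digits in the mixed radix expansion with radices \<open>N 0\<close>, \<open>N 1\<close>,
  and so on: one uniform label supplies a uniform symbol for every level, independently over the
  levels.\<close>

definition digit :: "(nat \<Rightarrow> nat) \<Rightarrow> nat \<Rightarrow> real \<Rightarrow> nat" where
  "digit N i t = nat (\<lfloor>t * (\<Prod>j\<le>i. real (N j))\<rfloor> mod int (N i))"

lemma digit_less: "0 < N i \<Longrightarrow> digit N i t < N i"
  by (simp add: digit_def nat_less_iff)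

lemma digit_measurable [measurable]: "digit N i \<in> borel \<rightarrow>\<^sub>M count_space UNIV"
  unfolding digit_def by measurable

lemma floor_eq_of_digits:
  assumes N: "\<And>i. 0 < N i" and "0 \<le> t" "t < 1" "0 \<le> t'" "t' < 1"
    and eq: "\<And>i. i < k \<Longrightarrow> digit N i t = digit N i t'"
  shows "\<lfloor>t * (\<Prod>j<k. real (N j))\<rfloor> = \<lfloor>t' * (\<Prod>j<k. real (N j))\<rfloor>"
  using eq
proof (induction k)
  case 0
  have "\<lfloor>t\<rfloor> = 0" "\<lfloor>t'\<rfloor> = 0" using assms by (simp_all add: floor_eq_iff)
  then show ?case by simp
next
  case (Suc k)
  define M where "M = (\<Prod>j<k. real (N j))"
  \<comment> \<open>Division with remainder by \<open>N k\<close>: refining the mesh by this factor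
    appends one digit.\<close>
  have split: "\<lfloor>t * (M * N k)\<rfloor> = \<lfloor>t * M\<rfloor> * int (N k) + int (digit N k t)" for t
  proof -
    have "\<lfloor>t * M\<rfloor> = \<lfloor>t * (M * N k) / real_of_int (int (N k))\<rfloor>" using N[of k] by simp
    also have "\<dots> = \<lfloor>t * (M * N k)\<rfloor> div int (N k)" by (rule floor_divide_real_eq_div) simp
    finally have "\<lfloor>t * M\<rfloor> = \<lfloor>t * (M * N k)\<rfloor> div int (N k)" .
    moreover have "int (digit N k t) = \<lfloor>t * (M * N k)\<rfloor> mod int (N k)"
      using N[of k] by (simp add: digit_def M_def lessThan_Suc_atMost[symmetric])
    ultimately show ?thesis by (simp add: mult.commute)
  qed
  have "\<lfloor>t * M\<rfloor> = \<lfloor>t' * M\<rfloor>" using Suc by (simp add: M_def)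
  then have "\<lfloor>t * (M * N k)\<rfloor> = \<lfloor>t' * (M * N k)\<rfloor>" unfolding split using Suc.prems[of k] by simp
  then show ?case by (simp add: M_def)
qed

section \<open>Probabilities of digit patterns\<close>

lemma prob_space_unif: "prob_space unif"
  by (rule prob_space_uniform_measure) simp_all

text \<open>Prescribed digits confine the label to one interval whose length is the reciprocal of
  the product of the radices, up to the null point 1. An upper bound is enough, as only bad events
  are estimated.\<close>

lemma unif_digits_le:
  assumes N: "\<And>i. 0 < N i"
  shows "measure unif {t. \<forall>i<k. digit N i t = p i} \<le> 1 / (\<Prod>j<k. real (N j))"
proof -
  define M where "M = (\<Prod>j<k. real (N j))"
  have M: "M > 0" unfolding M_def using N by (intro prod_pos) auto
  let ?E = "{t. \<forall>i<k. digit N i t = p i}"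
  have E: "?E \<in> sets borel"
    by measurable
  have "measure unif ?E = measure lborel ({0..1} \<inter> ?E)"
    using E by (simp add: measure_uniform_measure)
  also have "\<dots> \<le> 1 / M"
  proof (cases "{0..<1} \<inter> ?E = {}")
    case True
    then have "{0..1} \<inter> ?E \<subseteq> {1..1}" by force
    then have "measure lborel ({0..1} \<inter> ?E) \<le> measure lborel {1..1::real}"
      using E by (intro measure_mono_fmeasurable) (auto intro: fmeasurableI)
    then have "measure lborel ({0..1} \<inter> ?E) \<le> 0" by simp
    also have "0 \<le> 1 / M" using M by simp
    finally show ?thesis .
  next
    case False
    then obtain t0 where t0: "0 \<le> t0" "t0 < 1" "t0 \<in> ?E" by auto
    define n where "n = \<lfloor>t0 * M\<rfloor>"
    have "{0..1} \<inter> ?E \<subseteq> {n / M..(n + 1) / M} \<union> {1..1}"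
    proof
      fix t assume t: "t \<in> {0..1} \<inter> ?E"
      show "t \<in> {n / M..(n + 1) / M} \<union> {1..1}"
      proof (cases "t = 1")
        case False
        with t have "t < 1" by simp
        with t t0 have "\<lfloor>t * M\<rfloor> = n"
          unfolding n_def M_def by (intro floor_eq_of_digits N) auto
        then have "n \<le> t * M" "t * M < n + 1" by linarith+
        then show ?thesis using M by (simp add: field_simps)
      qed simp
    qed
    moreover have "{n / M..(n + 1) / M} \<union> {1..1} \<in> fmeasurable lborel"
      by (intro fmeasurable.Un) (auto intro!: fmeasurableI simp: emeasure_lborel_Icc_eq simp del: atLeastAtMost_singleton)
    ultimately have "measure lborel ({0..1} \<inter> ?E) \<le> measure lborel ({n / M..(n + 1) / M} \<union> {1..1})"
      using E by (intro measure_mono_fmeasurable) auto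
    also have "\<dots> \<le> measure lborel {n / M..(n + 1) / M} + measure lborel {1..1::real}"
      by (rule measure_Un_le) auto
    also have "\<dots> = 1 / M"
    proof -
      have "n / M \<le> (n + 1) / M" using M by (simp add: divide_right_mono)
      then show ?thesis using M by (simp add: diff_divide_distrib[symmetric])
    qed
    finally show ?thesis .
  qed
  finally show ?thesis by (simp add: M_def)
qed

lemma prob_space_labellings: "prob_space (labellings :: (int ^ 'd::finite \<Rightarrow> real) measure)"
  unfolding labellings_def by (intro prob_space_PiM prob_space_unif)

lemma space_labellings [simp]: "space (labellings :: (int ^ 'd::finite \<Rightarrow> real) measure) = UNIV"
  by (simp add: labellings_def space_PiM)

lemma measure_cylinder_le:
  fixes V :: "(int ^ 'd::finite) set"
  assumes N: "\<And>i. 0 < N i" and "finite V"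
  shows "{x. \<forall>u\<in>V. \<forall>i<k. digit N i (x u) = p i u} \<in> sets labellings"
    "measure labellings {x. \<forall>u\<in>V. \<forall>i<k. digit N i (x u) = p i u} \<le> (1 / (\<Prod>j<k. real (N j))) ^ card V"
proof -
  let ?E = "\<lambda>u. {t. \<forall>i<k. digit N i t = p i u}"
  have E: "?E u \<in> sets borel" for u by measurable
  have eq: "{x. \<forall>u\<in>V. \<forall>i<k. digit N i (x u) = p i u} = prod_emb UNIV (\<lambda>_. unif) V (PiE V ?E)"
    by (auto simp: prod_emb_def PiE_iff)
  show "{x. \<forall>u\<in>V. \<forall>i<k. digit N i (x u) = p i u} \<in> sets labellings"
    unfolding eq labellings_def using E \<open>finite V\<close> by (intro sets_PiM_I) auto
  interpret product_prob_space "\<lambda>_. unif" UNIV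
    by (intro product_prob_spaceI prob_space_unif)
  have "measure labellings {x. \<forall>u\<in>V. \<forall>i<k. digit N i (x u) = p i u} = (\<Prod>u\<in>V. measure unif (?E u))"
    unfolding eq labellings_def using E \<open>finite V\<close> by (intro measure_PiM_emb) auto
  also have "\<dots> \<le> (\<Prod>u\<in>V. 1 / (\<Prod>j<k. real (N j)))"
    by (intro prod_mono conjI unif_digits_le N) auto
  finally show "measure labellings {x. \<forall>u\<in>V. \<forall>i<k. digit N i (x u) = p i u} \<le> (1 / (\<Prod>j<k. real (N j))) ^ card V"
    by simp
qed

text \<open>The event is a finite union of cylinders, one for each choice of admissible patterns at
  all levels. Counting the choices yields the product over levels, which is how independence of the
  levels is used.\<close>

lemma measure_levels_le:
  fixes V :: "(int ^ 'd::finite) set"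
  assumes N: "\<And>i. 0 < N i" and V: "finite V"
    and B: "\<And>i. i < k \<Longrightarrow> B i \<subseteq> PiE V (\<lambda>_. {..<N i})"
  shows "{x. \<forall>i<k. restrict (\<lambda>u. digit N i (x u)) V \<in> B i} \<in> sets labellings"
    "measure labellings {x. \<forall>i<k. restrict (\<lambda>u. digit N i (x u)) V \<in> B i}
      \<le> (\<Prod>i<k. card (B i) / real (N i) ^ card V)"
proof -
  interpret prob_space "labellings :: (int ^ 'd \<Rightarrow> real) measure" by (rule prob_space_labellings)
  let ?P = "PiE {..<k} B"
  let ?C = "\<lambda>p. {x. \<forall>u\<in>V. \<forall>i<k. digit N i (x u) = p i u}"
  have finB: "finite (B i)" if "i < k" for i
    using B[OF that] by (rule finite_subset) (auto intro!: finite_PiE V)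
  then have finP: "finite ?P" by (intro finite_PiE) auto
  have eq: "{x. \<forall>i<k. restrict (\<lambda>u. digit N i (x u)) V \<in> B i} = (\<Union>p\<in>?P. ?C p)"
  proof (intro set_eqI iffI)
    fix x assume "x \<in> {x. \<forall>i<k. restrict (\<lambda>u. digit N i (x u)) V \<in> B i}"
    then have "restrict (\<lambda>i. restrict (\<lambda>u. digit N i (x u)) V) {..<k} \<in> ?P" by auto
    then show "x \<in> (\<Union>p\<in>?P. ?C p)" by (rule UN_I) auto
  next
    fix x assume "x \<in> (\<Union>p\<in>?P. ?C p)"
    then obtain p where p: "p \<in> ?P" "x \<in> ?C p" by blast
    have "restrict (\<lambda>u. digit N i (x u)) V = p i" if "i < k" for i
    proof -
      have "p i \<in> B i" using p that by (auto simp: PiE_iff)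
      then have "p i \<in> extensional V" using B[OF that] by (auto simp: PiE_def)
      then show ?thesis using p(2) that by (auto simp: fun_eq_iff extensional_def)
    qed
    then show "x \<in> {x. \<forall>i<k. restrict (\<lambda>u. digit N i (x u)) V \<in> B i}" using p by (auto simp: PiE_iff)
  qed
  show "{x. \<forall>i<k. restrict (\<lambda>u. digit N i (x u)) V \<in> B i} \<in> sets labellings"
    unfolding eq using finP measure_cylinder_le(1)[OF N V] by (intro sets.finite_UN) auto
  have "measure labellings (\<Union>p\<in>?P. ?C p) \<le> (\<Sum>p\<in>?P. measure labellings (?C p))"
    using finP measure_cylinder_le(1)[OF N V] by (intro finite_measure_subadditive_finite) auto
  also have "\<dots> \<le> (\<Sum>p\<in>?P. (1 / (\<Prod>j<k. real (N j))) ^ card V)"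
    by (intro sum_mono measure_cylinder_le(2) N V)
  also have "\<dots> = (\<Prod>i<k. real (card (B i))) * (1 / (\<Prod>j<k. real (N j))) ^ card V"
    by (simp add: card_PiE)
  also have "\<dots> = (\<Prod>i<k. card (B i) / real (N i) ^ card V)"
    by (simp add: prod_dividef power_divide prod_power_distrib)
  finally show "measure labellings {x. \<forall>i<k. restrict (\<lambda>u. digit N i (x u)) V \<in> B i}
      \<le> (\<Prod>i<k. card (B i) / real (N i) ^ card V)" unfolding eq .
qed

section \<open>The scales and the law of the weights\<close>

text \<open>The unit in which gaps and margins of level \<open>i\<close> are measured; it becomes
  \<open>\<tau> i\<close>. Weights reach \<open>128 * 4 ^ i\<close> units and must fit below the
  next unit, whence the square in the exponent.\<close>

definition toast_scale :: "nat \<Rightarrow> nat \<Rightarrow> nat" where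
  "toast_scale e i = 2 ^ (e + 8 * i + i * i)"

text \<open>The factor 64 makes the smallest type four times the gap of 16 units by which a vertex
  is to win.\<close>

definition type_size :: "nat \<Rightarrow> nat \<Rightarrow> nat \<Rightarrow> nat" where
  "type_size e i a = 64 * toast_scale e i * 4 ^ a"

text \<open>For \<open>h \<ge> 4 * d\<close> a ball of radius h / 2 has at least (h / (4 d))^d
  points besides its centre, so with this constant times h^(-d) as density the mean number is at
  least 3.\<close>

definition density_const :: "nat \<Rightarrow> nat" where
  "density_const d = 3 * (4 * d) ^ d"

lemma toast_scale_Suc: "toast_scale e (Suc i) = 512 * 4 ^ i * toast_scale e i"
proof -
  have "(4 :: nat) ^ i = 2 ^ (2 * i)" by (simp add: power_mult)
  moreover have "(512 :: nat) = 2 ^ 9" by simp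
  ultimately show ?thesis by (simp only: toast_scale_def power_add[symmetric]) (simp add: algebra_simps)
qed

lemma toast_scale_ge: "2 ^ e \<le> toast_scale e i"
  unfolding toast_scale_def by (intro power_increasing) auto

lemma toast_scales_toast_scale:
  assumes "q \<le> 2 ^ e"
  shows "toast_scales q (\<lambda>i. 8 * toast_scale e i) (\<lambda>i. 128 * toast_scale e i * 4 ^ i) (\<lambda>i. 2 * toast_scale e i) (toast_scale e)"
proof
  fix i
  have "0 < toast_scale e i" by (simp add: toast_scale_def)
  then show "2 * toast_scale e i + 2 * (2 * toast_scale e i) < 8 * toast_scale e i" by simp
  show "toast_scale e i + q \<le> 2 * toast_scale e i" using assms toast_scale_ge[of e i] by simp
  have "toast_scale e i * 1 \<le> toast_scale e i * 4 ^ i" by (intro mult_le_mono2) simp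
  then have "toast_scale e i \<le> toast_scale e i * 4 ^ i" by (simp only: mult.right_neutral)
  then show "2 * (128 * toast_scale e i * 4 ^ i) + 3 * toast_scale e i + 2 * (2 * toast_scale e i) \<le> toast_scale e (Suc i)"
    unfolding toast_scale_Suc by (simp only: ac_simps)
qed

lemma exists_fun_with_fiber_cards:
  fixes S :: "nat set"
  assumes "finite S" "finite Y" "0 \<notin> S" "(\<Sum>t\<in>S. c t) \<le> card Y"
  shows "\<exists>g. (\<forall>t\<in>S. card {y \<in> Y. g y = t} = c t) \<and> (\<forall>y :: nat. g y \<in> insert 0 S)"
  using assms
proof (induction S arbitrary: Y rule: finite_induct)
  case empty
  show ?case by (rule exI[of _ "\<lambda>_. 0"]) simp
next
  case (insert t S)
  then have "c t \<le> card Y" by simp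
  then obtain Y' where Y': "Y' \<subseteq> Y" "card Y' = c t" "finite Y'"
    by (rule obtain_subset_with_card_n)
  then have "(\<Sum>t\<in>S. c t) \<le> card (Y - Y')" using insert by (simp add: card_Diff_subset)
  then have "\<exists>g. (\<forall>t\<in>S. card {y \<in> Y - Y'. g y = t} = c t) \<and> (\<forall>y. g y \<in> insert 0 S)"
    using insert.prems by (intro insert.IH) auto
  then obtain g where g: "\<And>t. t \<in> S \<Longrightarrow> card {y \<in> Y - Y'. g y = t} = c t" "\<And>y. g y \<in> insert 0 S"
    by blast
  let ?g = "\<lambda>y. if y \<in> Y' then t else g y"
  have "g y \<noteq> t" for y using g(2)[of y] insert.hyps insert.prems by auto
  then have "{y \<in> Y. ?g y = t} = Y'" using Y'(1) by auto
  moreover have "{y \<in> Y. ?g y = t'} = {y \<in> Y - Y'. g y = t'}" if "t' \<in> S" for t'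
    using that insert by auto
  ultimately have "\<forall>t'\<in>insert t S. card {y \<in> Y. ?g y = t'} = c t'" using g(1) Y' by auto
  moreover have "?g y \<in> insert 0 (insert t S)" for y using g(2)[of y] by auto
  ultimately show ?case by (intro exI[of _ ?g] conjI allI)
qed

text \<open>With \<open>h i ^ Suc d\<close> symbols and these multiplicities,
  \<open>\<kappa> a * h a ^ Suc d\<close> is the same multiple of \<open>N\<close> for all types. So
  type \<open>a\<close> has density \<open>c / h a ^ d\<close>, of constant order in balls of its
  own size, and \<open>many\<close> and \<open>few\<close> become volume estimates.\<close>

lemma exists_weight_law:
  assumes e: "density_const (CARD('d)) \<le> 2 ^ e"
  shows "\<exists>g. (\<forall>y. g y \<le> 128 * toast_scale e i * 4 ^ i) \<and>
    (\<forall>v :: int ^ 'd::finite. weight_law (16 * toast_scale e i) i (type_size e i i ^ Suc (CARD('d))) (type_size e i)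
      (\<lambda>a. density_const (CARD('d)) * (4 ^ (i - a)) ^ Suc (CARD('d))) g
      (density_const (CARD('d)) * 5 ^ CARD('d)) v)"
proof -
  define d where "d = CARD('d)"
  have d: "0 < d" by (simp add: d_def)
  define c where "c = density_const d"
  define h where "h = type_size e i"
  define \<kappa> where "\<kappa> a = c * (4 ^ (i - a)) ^ Suc d" for a
  define N where "N = h i ^ Suc d"
  have h_Suc: "h (Suc a) = 4 * h a" for a by (simp add: h_def type_size_def)
  have h_pos: "0 < h a" for a by (simp add: h_def type_size_def toast_scale_def)
  have N_pos: "0 < N" using h_pos by (simp add: N_def)
  have h_mono: "a \<le> b \<Longrightarrow> h a \<le> h b" for a b by (simp add: h_def type_size_def)
  have kappa: "\<kappa> a * h a ^ Suc d = c * N" if "a \<le> i" for a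
  proof -
    have "h i = 4 ^ (i - a) * h a" using that by (simp add: h_def type_size_def flip: power_add)
    then show ?thesis by (simp only: \<kappa>_def N_def power_mult_distrib mult.assoc)
  qed
  \<comment> \<open>A large \<open>e\<close> keeps the density of type \<open>a\<close> at most
    \<open>1 / 2 ^ Suc a\<close>, so that all types together fit into \<open>N\<close>
    symbols.\<close>
  have hc: "c * 2 ^ Suc a \<le> h a" for a
  proof -
    have "c \<le> toast_scale e i" using e toast_scale_ge[of e i] by (simp add: c_def d_def)
    moreover have "(2 :: nat) ^ Suc a \<le> 64 * 4 ^ a" using power_mono[of 2 "4 :: nat" a] by simp
    ultimately have "c * 2 ^ Suc a \<le> toast_scale e i * (64 * 4 ^ a)" by (rule mult_le_mono)
    then show ?thesis by (simp add: h_def type_size_def mult.commute mult.left_commute)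
  qed
  have c_ge: "4 * d \<le> c" "0 < c"
  proof -
    have "(4 * d) ^ 1 \<le> (4 * d) ^ d" using d by (intro power_increasing) auto
    then show "4 * d \<le> c" by (simp add: c_def density_const_def)
    then show "0 < c" using d by simp
  qed
  have part: "\<kappa> a * h a * 2 ^ Suc a \<le> N" if "a \<le> i" for a
  proof -
    have "c * (\<kappa> a * h a * 2 ^ Suc a) = \<kappa> a * h a * (c * 2 ^ Suc a)" by (simp add: ac_simps)
    also have "\<dots> \<le> \<kappa> a * h a * h a ^ 1" using hc[of a] by (intro mult_le_mono2) simp
    also have "\<dots> \<le> \<kappa> a * h a * h a ^ d"
      using d h_pos[of a] by (intro mult_le_mono2 power_increasing) auto
    also have "\<dots> = c * N" using kappa[OF that] by (simp add: mult.assoc)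
    finally show ?thesis using c_ge by simp
  qed
  have total: "(\<Sum>a\<le>i. \<kappa> a * h a) \<le> N"
  proof -
    have "real (\<Sum>a\<le>i. \<kappa> a * h a) \<le> (\<Sum>a\<le>i. N * (1 / 2) * (1 / 2) ^ a)"
      unfolding of_nat_sum
    proof (rule sum_mono)
      fix a assume "a \<in> {..i}"
      then have "real (\<kappa> a * h a * 2 ^ Suc a) \<le> N" using part[of a] by (intro of_nat_mono) auto
      then show "real (\<kappa> a * h a) \<le> N * (1 / 2) * (1 / 2) ^ a"
        by (simp add: field_simps power_divide)
    qed
    also have "\<dots> = N * (1 / 2) * (\<Sum>a\<le>i. (1 / 2) ^ a)" by (simp add: sum_distrib_left)
    also have "\<dots> \<le> N * (1 / 2) * 2"
      by (intro mult_left_mono) (subst sum_gp0, auto simp: field_simps)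
    finally have "real (\<Sum>a\<le>i. \<kappa> a * h a) \<le> real N" by simp
    then show ?thesis by (simp only: of_nat_le_iff)
  qed
  let ?type = "\<lambda>a. {h a..<2 * h a}"
  have disj: "?type a \<inter> ?type b = {}" if "a \<noteq> b" for a b
    using h_mono[of "Suc a" b] h_mono[of "Suc b" a] that by (cases "a < b") (auto simp: h_Suc)
  define S where "S = (\<Union>a\<in>{..i}. ?type a)"
  define w where "w t = (\<Sum>a\<le>i. if t \<in> ?type a then \<kappa> a else 0)" for t
  have w: "w t = \<kappa> a" if "a \<le> i" "t \<in> ?type a" for a t
  proof -
    have "w t = (\<Sum>b\<le>i. if b = a then \<kappa> b else 0)"
      unfolding w_def using that disj by (intro sum.cong refl) (metis disjoint_iff)
    then show ?thesis using that by simp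
  qed
  have "(\<Sum>t\<in>S. w t) = (\<Sum>a\<le>i. \<Sum>t\<in>?type a. w t)"
    unfolding S_def using disj by (intro sum.UNION_disjoint) auto
  also have "\<dots> = (\<Sum>a\<le>i. \<Sum>t\<in>?type a. \<kappa> a)" using w by (intro sum.cong refl) auto
  also have "\<dots> \<le> card {..<N}" using total by (simp add: mult.commute)
  finally have "\<exists>g. (\<forall>t\<in>S. card {y \<in> {..<N}. g y = t} = w t) \<and> (\<forall>y :: nat. g y \<in> insert 0 S)"
    using h_pos by (intro exists_fun_with_fiber_cards) (auto simp: S_def)
  then obtain g where g: "\<And>t. t \<in> S \<Longrightarrow> card {y \<in> {..<N}. g y = t} = w t" "\<And>y. g y \<in> insert 0 S"
    by blast
  have bound: "g y \<le> 128 * toast_scale e i * 4 ^ i" for y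
  proof -
    have "g y \<le> 2 * h i"
    proof (cases "g y = 0")
      case False
      with g(2)[of y] obtain a where "a \<le> i" "g y < 2 * h a" by (auto simp: S_def)
      with h_mono[of a i] show ?thesis by linarith
    qed simp
    then show ?thesis by (simp add: h_def type_size_def)
  qed
  have "weight_law (16 * toast_scale e i) i N h \<kappa> g (c * 5 ^ d) v" for v :: "int ^ 'd"
  proof
    fix b assume b: "b \<le> i"
    define k where "k = h b div 2 div d"
    have k: "d * k \<le> h b div 2" by (simp add: k_def)
    have hb: "4 * d \<le> h b" 
    proof -
      have "4 * d \<le> c * 1" using c_ge(1) by simp
      also have "\<dots> \<le> c * 2 ^ Suc b" by (intro mult_le_mono2) simp
      also have "\<dots> \<le> h b" by (rule hc)
      finally show ?thesis .
    qed
    \<comment> \<open>Rounding in the two divisions loses at most a factor 2, because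
      \<open>k\<close> is positive.\<close>
    have "h b \<le> 4 * d * k"
    proof -
      have "h b div 2 = d * k + h b div 2 mod d" "h b div 2 mod d < d" using d by (simp_all add: k_def)
      moreover have "d * 1 \<le> d * k"
        using hb d unfolding k_def by (intro mult_le_mono2) (simp add: less_eq_div_iff_mult_less_eq)
      ultimately have "2 * (h b div 2) + 1 \<le> 4 * (d * k)" by linarith
      then show ?thesis by (simp add: mult.assoc)
    qed
    have "3 * N = 3 * (4 ^ (i - b)) ^ Suc d * h b * h b ^ d"
    proof -
      have "c * (3 * N) = 3 * (\<kappa> b * h b ^ Suc d)" using kappa[OF b] by simp
      also have "\<dots> = c * (3 * (4 ^ (i - b)) ^ Suc d * h b * h b ^ d)" by (simp add: \<kappa>_def ac_simps)
      finally show ?thesis using c_ge(2) by (simp only: mult_cancel1) auto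
    qed
    also have "\<dots> \<le> 3 * (4 ^ (i - b)) ^ Suc d * h b * (4 * d * k) ^ d"
      using \<open>h b \<le> 4 * d * k\<close> by (intro mult_le_mono2 power_mono) auto
    also have "\<dots> = \<kappa> b * h b * k ^ d"
      by (simp add: \<kappa>_def c_def density_const_def power_mult_distrib ac_simps)
    also have "\<dots> \<le> \<kappa> b * h b * (card (grid_ball v (h b div 2)) - 1)"
    proof (intro mult_le_mono2)
      have "k ^ d < (k + 1) ^ d" using d by (intro power_strict_mono) auto
      with card_grid_ball_ge[of k "h b div 2" v] k show "k ^ d \<le> card (grid_ball v (h b div 2)) - 1"
        by (simp add: d_def)
    qed
    finally show "3 * N \<le> \<kappa> b * h b * (card (grid_ball v (h b div 2)) - 1)" .
  next
    fix a assume a: "a \<le> i"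
    have "card (grid_ball v (2 * h a)) \<le> (5 * h a) ^ d"
    proof -
      have "2 * (2 * h a) + 1 \<le> 5 * h a" using h_pos[of a] by simp
      then have "(2 * (2 * h a) + 1) ^ d \<le> (5 * h a) ^ d" by (intro power_mono) auto
      with card_grid_ball_le[of v "2 * h a"] show ?thesis unfolding d_def by (rule order_trans)
    qed
    then have "\<kappa> a * h a * card (grid_ball v (2 * h a)) \<le> \<kappa> a * h a * (5 * h a) ^ d"
      by (rule mult_le_mono2)
    also have "\<dots> = c * 5 ^ d * N"
      using kappa[OF a] by (simp add: power_mult_distrib ac_simps)
    finally have "real (\<kappa> a * h a * card (grid_ball v (2 * h a))) \<le> real (c * 5 ^ d * N)"
      by (rule of_nat_mono)
    then show "real (\<kappa> a * h a * card (grid_ball v (2 * h a))) \<le> real (c * 5 ^ d) * real N" by simp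
  next
    fix a t assume "a \<le> i" "t \<in> ?type a"
    then show "card {y \<in> {..<N}. g y = t} = \<kappa> a" using g(1)[of t] w[of a t] by (auto simp: S_def)
  next
    fix y assume "g y \<noteq> 0"
    then show "\<exists>a\<le>i. g y \<in> ?type a" using g(2)[of y] by (auto simp: S_def)
  qed (use N_pos in \<open>auto simp: h_def type_size_def toast_scale_def\<close>)
  with bound show ?thesis
    unfolding N_def h_def \<kappa>_def c_def d_def by (intro exI[of _ g]) simp
qed

section \<open>The algorithm\<close>

text \<open>Level \<open>i\<close> reads its symbols from digit \<open>i\<close> of the labels.
  Since \<open>\<tau> 0\<close> is positive, \<open>radius j\<close> is at least \<open>j\<close>,
  so a ball of radius \<open>r\<close> can only decide levels up to \<open>r\<close>.\<close>

locale toast_digits = toast_scales +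
  fixes N :: "nat \<Rightarrow> nat" and g :: "nat \<Rightarrow> nat \<Rightarrow> nat"
  assumes tau_pos: "0 < \<tau> 0"
    and radix_pos: "0 < N i"
    and weight_le: "g i y \<le> m i"
begin

definition weights :: "(int ^ 'd::finite \<Rightarrow> real) \<Rightarrow> nat \<Rightarrow> int ^ 'd \<Rightarrow> nat" where
  "weights x i u = g i (digit N i (x u))"

definition covered :: "(int ^ 'd::finite \<Rightarrow> real) \<Rightarrow> int ^ 'd \<Rightarrow> nat \<Rightarrow> bool" where
  "covered x v j \<longleftrightarrow> (\<exists>D\<in>pieces (weights x) j. v \<in> D)"

text \<open>A piece of level \<open>j\<close> at the origin lies within
  \<open>\<tau> (Suc j)\<close>, and \<open>engulf_pieces_local\<close> looks
  \<open>\<tau> (Suc j)\<close> further.\<close>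

definition radius :: "nat \<Rightarrow> nat" where
  "radius j = 2 * \<tau> (Suc j)"

text \<open>A view is \<open>undefined\<close> off its ball, so levels whose radius exceeds
  \<open>r\<close> may come out wrong. The least covered level is safe: it is at most the level that
  triggered the stop.\<close>

definition toast_alg :: "('d::finite, (int ^ 'd) set) local_alg" where
  "toast_alg = \<lparr>
     stops = (\<lambda>r. {z \<in> space (ball_labellings r). \<exists>j. radius j \<le> r \<and> covered z 0 j}),
     out = (\<lambda>r z. THE D. D \<in> pieces (weights z) (LEAST j. covered z 0 j) \<and> 0 \<in> D)\<rparr>"

section \<open>Locality of the algorithm and correctness of its output\<close>

lemma radius_mono: "i \<le> j \<Longrightarrow> radius i \<le> radius j"
  by (simp add: radius_def tau_mono)

lemma level_le_radius: "j \<le> radius j"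
proof -
  have "j < \<tau> j" for j
  proof (induction j)
    case (Suc j)
    then show ?case using growth[of j] by linarith
  qed (rule tau_pos)
  from this[of "Suc j"] show ?thesis by (simp add: radius_def)
qed

lemma piece_local:
  assumes eq: "\<And>i u. i \<le> j \<Longrightarrow> u \<in> grid_ball 0 (radius j) \<Longrightarrow> weights x i u = weights y i u"
    and D: "D \<in> pieces (weights x) j" "0 \<in> D"
  shows "D \<in> pieces (weights y) j"
proof (rule engulf_pieces_local[where v = 0 and n = "\<tau> (Suc j)", OF _ _ _ D(1)])
  have "D \<subseteq> grid_ball 0 (2 * (m j + \<tau> j))"
    using D weight_le by (intro piece_subset_ball) (auto simp: weights_def)
  also have "\<dots> \<subseteq> grid_ball 0 (\<tau> (Suc j))" using growth[of j] by (auto simp: grid_ball_def)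
  finally show "D \<subseteq> grid_ball 0 (\<tau> (Suc j))" .
  show "weights x i u = weights y i u" if "i \<le> j" "u \<in> grid_ball 0 (\<tau> (Suc j) + \<tau> (Suc j))" for i u
    using that by (intro eq) (simp_all add: radius_def mult_2)
qed (simp_all add: weights_def weight_le)

lemma pieces_at_0_cong:
  assumes "\<And>i u. i \<le> j \<Longrightarrow> u \<in> grid_ball 0 (radius j) \<Longrightarrow> weights x i u = weights y i u"
  shows "{D \<in> pieces (weights x) j. 0 \<in> D} = {D \<in> pieces (weights y) j. 0 \<in> D}"
  using piece_local[of j x y] piece_local[of j y x] assms by auto

lemma covered_cong:
  assumes "\<And>i u. i \<le> j \<Longrightarrow> u \<in> grid_ball 0 (radius j) \<Longrightarrow> weights x i u = weights y i u"
  shows "covered x 0 j \<longleftrightarrow> covered y 0 j"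
  using pieces_at_0_cong[OF assms] by (auto simp: covered_def)

text \<open>Up to level \<open>j\<close> both labellings cover the origin at the same levels, so the
  two least levels agree.\<close>

lemma out_cong:
  assumes eq: "\<And>i u. i \<le> r \<Longrightarrow> u \<in> grid_ball 0 r \<Longrightarrow> weights x i u = weights y i u"
    and j: "covered x 0 j" "radius j \<le> r"
  shows "out toast_alg r x = out toast_alg r y"
proof -
  have eq': "weights x i u = weights y i u" if "k \<le> j" "i \<le> k" "u \<in> grid_ball 0 (radius k)" for i k u
    using that j(2) radius_mono[of k j] level_le_radius[of j] by (intro eq) (auto simp: grid_ball_def)
  have cov: "covered x 0 k \<longleftrightarrow> covered y 0 k" if "k \<le> j" for k
    using that eq' by (intro covered_cong) blast
  let ?L = "LEAST j. covered x 0 j"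
  have L: "covered x 0 ?L" "?L \<le> j" using j(1) by (auto intro: LeastI Least_le)
  then have "(LEAST j. covered y 0 j) = ?L"
  proof (intro Least_equality)
    show "covered y 0 ?L" using cov[OF L(2)] L(1) by blast
    show "?L \<le> k" if "covered y 0 k" for k
    proof (cases "k \<le> j")
      case True
      with cov that show ?thesis by (intro Least_le) blast
    next
      case False
      with L(2) show ?thesis by simp
    qed
  qed
  moreover have "{D \<in> pieces (weights x) ?L. 0 \<in> D} = {D \<in> pieces (weights y) ?L. 0 \<in> D}"
    using eq' L(2) by (intro pieces_at_0_cong) blast
  then have "D \<in> pieces (weights x) ?L \<and> 0 \<in> D \<longleftrightarrow> D \<in> pieces (weights y) ?L \<and> 0 \<in> D" for D
    by blast
  ultimately show ?thesis by (simp add: toast_alg_def)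
qed

lemma out_eqI:
  assumes "D \<in> pieces (weights z) (LEAST j. covered z 0 j)" "0 \<in> D"
  shows "out toast_alg r z = D"
proof -
  have "(THE D. D \<in> pieces (weights z) (LEAST j. covered z 0 j) \<and> 0 \<in> D) = D"
  proof (rule the_equality)
    fix D' assume "D' \<in> pieces (weights z) (LEAST j. covered z 0 j) \<and> 0 \<in> D'"
    then show "D' = D" using assms by (intro pieces_disjoint) (auto simp: weights_def weight_le)
  qed (use assms in blast)
  then show ?thesis by (simp add: toast_alg_def)
qed

lemma pieces_translate:
  "pieces (weights x) j = (`) ((+) v) ` pieces (weights (\<lambda>u. x (v + u))) j"
  using engulf_translate(2)[of "weights x" j v] by (simp add: weights_def[abs_def])

lemma covered_view:
  assumes "radius j \<le> r"
  shows "covered (view x v r) 0 j \<longleftrightarrow> covered x v j"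
proof -
  have "covered (view x v r) 0 j \<longleftrightarrow> covered (\<lambda>u. x (v + u)) 0 j"
    using assms by (intro covered_cong) (auto simp: view_def weights_def grid_ball_def)
  also have "\<dots> \<longleftrightarrow> covered x v j"
    unfolding covered_def pieces_translate[of x j v] by (force simp: image_iff)
  finally show ?thesis .
qed

lemma view_in_stops_iff: "view x v r \<in> stops toast_alg r \<longleftrightarrow> (\<exists>j. radius j \<le> r \<and> covered x v j)"
proof -
  have "view x v r \<in> space (ball_labellings r)"
    using measurable_space[OF view_measurable, of x v r] by (simp add: labellings_def space_PiM)
  then show ?thesis by (auto simp: toast_alg_def covered_view)
qed

lemma coding_radius_le: "covered x v j \<Longrightarrow> coding_radius toast_alg x v \<le> enat (radius j)"
  unfolding coding_radius_le_iff view_in_stops_iff by auto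

text \<open>As radii are monotone in the level, the exploration stops exactly when the least
  covering level becomes visible.\<close>

lemma computes_least_piece:
  assumes D: "D \<in> pieces (weights x) j" "v \<in> D" and least: "\<And>i. covered x v i \<Longrightarrow> j \<le> i"
  shows "computes toast_alg x v ((\<lambda>u. u - v) ` D)"
  unfolding computes_def
proof (intro exI conjI)
  have cov: "covered x v j" using D by (auto simp: covered_def)
  show "coding_radius toast_alg x v = enat (radius j)"
  proof (rule antisym[OF coding_radius_le[OF cov]])
    show "enat (radius j) \<le> coding_radius toast_alg x v"
      unfolding coding_radius_def
    proof (rule INF_greatest)
      fix r assume "r \<in> {r. view x v r \<in> stops toast_alg r}"
      then obtain i where "radius i \<le> r" "covered x v i" by (auto simp: view_in_stops_iff)
      with least radius_mono[of j i] show "enat (radius j) \<le> enat r" by fastforce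
    qed
  qed
  let ?z = "view x v (radius j)"
  obtain D0 where D0: "D0 \<in> pieces (weights (\<lambda>u. x (v + u))) j" "D = (+) v ` D0"
    using D(1) unfolding pieces_translate[of x j v] by blast
  then have sub: "(\<lambda>u. u - v) ` D = D0" by (force simp: image_iff)
  have "0 \<in> D0" using D(2) D0 by auto
  have "D0 \<in> pieces (weights ?z) j"
  proof (rule piece_local[OF _ D0(1) \<open>0 \<in> D0\<close>])
    show "weights (\<lambda>u. x (v + u)) i u = weights ?z i u" if "u \<in> grid_ball 0 (radius j)" for i u
      using that by (simp add: view_def weights_def)
  qed
  moreover have "(LEAST j. covered ?z 0 j) = j"
  proof (rule Least_equality)
    show "covered ?z 0 j" using covered_view cov by blast
    show "j \<le> i" if "covered ?z 0 i" for i
    proof (rule ccontr)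
      assume "\<not> j \<le> i"
      then have "radius i \<le> radius j" by (intro radius_mono) simp
      with that least \<open>\<not> j \<le> i\<close> show False by (simp add: covered_view)
    qed
  qed
  ultimately show "out toast_alg (radius j) ?z = (\<lambda>u. u - v) ` D"
    unfolding sub using \<open>0 \<in> D0\<close> by (intro out_eqI) simp_all
qed

text \<open>Finitely many digits take finitely many patterns, so a set that depends only on them is
  a finite union of measurable sets. Measurability of the algorithm rests on this.\<close>

lemma sets_of_finitely_many_digits:
  fixes Q :: "(int ^ 'd::finite \<Rightarrow> real) \<Rightarrow> bool"
  assumes "\<And>z z'. z \<in> space (ball_labellings r) \<Longrightarrow> z' \<in> space (ball_labellings r) \<Longrightarrow>
    (\<And>i u. i \<le> k \<Longrightarrow> u \<in> grid_ball 0 r \<Longrightarrow> digit N i (z u) = digit N i (z' u)) \<Longrightarrow> Q z \<Longrightarrow> Q z'"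
  shows "{z \<in> space (ball_labellings r). Q z} \<in> sets (ball_labellings r)"
proof -
  let ?B = "ball_labellings r :: (int ^ 'd \<Rightarrow> real) measure"
  let ?I = "{..k} \<times> (grid_ball 0 r :: (int ^ 'd) set)"
  let ?pat = "\<lambda>z. restrict (\<lambda>(i, u). digit N i (z u)) ?I"
  let ?P = "{p \<in> PiE ?I (\<lambda>(i, u). {..<N i}). \<exists>z\<in>space ?B. Q z \<and> ?pat z = p}"
  let ?C = "\<lambda>p. {z \<in> space ?B. \<forall>i\<in>{..k}. \<forall>u\<in>grid_ball 0 r. digit N i (z u) = p (i, u)}"
  have fin: "finite ?P"
    by (rule finite_subset[of _ "PiE ?I (\<lambda>(i, u). {..<N i})"]) (auto intro!: finite_PiE)
  have C: "?C p \<in> sets ?B" for p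
  proof (intro sets.sets_Collect_finite_All)
    fix i u assume "u \<in> (grid_ball 0 r :: (int ^ 'd) set)"
    then have "(\<lambda>z. z u) \<in> measurable ?B unif"
      unfolding ball_labellings_def by (rule measurable_component_singleton)
    moreover have "digit N i \<in> measurable unif (count_space UNIV)"
      using digit_measurable[of N i] by (simp cong: measurable_cong_sets)
    ultimately have "(\<lambda>z. digit N i (z u)) \<in> measurable ?B (count_space UNIV)"
      by (rule measurable_compose)
    then show "{z \<in> space ?B. digit N i (z u) = p (i, u)} \<in> sets ?B"
      by measurable
  qed auto
  have eq: "{z \<in> space ?B. Q z} = (\<Union>p\<in>?P. ?C p)"
  proof (intro set_eqI iffI)
    fix z assume z: "z \<in> {z \<in> space ?B. Q z}"
    then have "?pat z \<in> ?P" by (auto simp: digit_less radix_pos)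
    moreover have "z \<in> ?C (?pat z)" using z by auto
    ultimately show "z \<in> (\<Union>p\<in>?P. ?C p)" by (rule UN_I[where a = "?pat z" and B = ?C])
  next
    fix z assume "z \<in> (\<Union>p\<in>?P. ?C p)"
    then obtain z' where z': "z' \<in> space ?B" "Q z'" "z \<in> ?C (?pat z')" by blast
    moreover have "digit N i (z' u) = digit N i (z u)" if "i \<le> k" "u \<in> grid_ball 0 r" for i u
      using z'(3) that by auto
    ultimately show "z \<in> {z \<in> space ?B. Q z}" using assms[of z' z] by blast
  qed
  show ?thesis unfolding eq by (rule sets.finite_UN[OF fin C])
qed

lemma uniform_toast_alg:
  "uniform_local_algorithm (count_space {D. finite D}) (toast_alg :: ('d::finite, (int ^ 'd) set) local_alg)"
  unfolding uniform_local_algorithm_def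
proof (intro conjI allI)
  fix r
  let ?A = "toast_alg :: ('d, (int ^ 'd) set) local_alg"
  have weights_eq: "weights z i u = weights z' i u"
    if "digit N i (z u) = digit N i (z' u)" for z z' :: "int ^ 'd \<Rightarrow> real" and i u
    using that by (simp add: weights_def)
  have cov: "covered z' 0 j" if "covered z 0 j" "radius j \<le> r"
    "\<And>i u. i \<le> r \<Longrightarrow> u \<in> grid_ball 0 r \<Longrightarrow> digit N i (z u) = digit N i (z' u)" for z z' :: "int ^ 'd \<Rightarrow> real" and j
  proof -
    have "weights z i u = weights z' i u" if "i \<le> j" "u \<in> grid_ball 0 (radius j)" for i u
      using that \<open>radius j \<le> r\<close> level_le_radius[of j]
      by (intro weights_eq \<open>\<And>i u. i \<le> r \<Longrightarrow> u \<in> grid_ball 0 r \<Longrightarrow> digit N i (z u) = digit N i (z' u)\<close>)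
        (auto simp: grid_ball_def)
    from covered_cong[OF this] that(1) show ?thesis by blast
  qed
  have stops: "stops ?A r = {z \<in> space (ball_labellings r). \<exists>j. radius j \<le> r \<and> covered z 0 j}"
    by (simp add: toast_alg_def)
  show sets_stops: "stops ?A r \<in> sets (ball_labellings r)"
    unfolding stops by (rule sets_of_finitely_many_digits[where k = r]) (use cov in blast)
  have sp: "space (restrict_space (ball_labellings r) (stops ?A r)) = stops ?A r"
    by (simp add: space_restrict_space Int_absorb2 sets.sets_into_space[OF sets_stops])
  have countable: "countable {D :: (int ^ 'd) set. finite D}"
    using countable_Collect_finite by simp
  show "out ?A r \<in> measurable (restrict_space (ball_labellings r) (stops ?A r)) (count_space {D. finite D})"
  proof (rule measurable_count_space_eq_countable[OF countable, THEN iffD2], intro conjI ballI)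
    show "out ?A r \<in> space (restrict_space (ball_labellings r) (stops ?A r)) \<rightarrow> {D. finite D}"
    proof
      fix z assume "z \<in> space (restrict_space (ball_labellings r) (stops ?A r))"
      then have "z \<in> stops ?A r" unfolding sp .
      then obtain j where "covered z 0 j" unfolding stops by blast
      then have "covered z 0 (LEAST j. covered z 0 j)" by (rule LeastI)
      then obtain D where D: "D \<in> pieces (weights z) (LEAST j. covered z 0 j)" "0 \<in> D"
        by (auto simp: covered_def)
      have "finite D" using D(1) by (rule piece_finite[rotated]) (simp add: weights_def weight_le)
      with out_eqI[OF D] show "out ?A r z \<in> {D. finite D}" by simp
    qed
    fix D :: "(int ^ 'd) set"
    have "{z \<in> space (ball_labellings r). (\<exists>j. radius j \<le> r \<and> covered z 0 j) \<and> out ?A r z = D}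
        \<in> sets (ball_labellings r)"
    proof (rule sets_of_finitely_many_digits[where k = r])
      fix z z' :: "int ^ 'd \<Rightarrow> real"
      assume eq: "\<And>i u. i \<le> r \<Longrightarrow> u \<in> grid_ball 0 r \<Longrightarrow> digit N i (z u) = digit N i (z' u)"
        and "(\<exists>j. radius j \<le> r \<and> covered z 0 j) \<and> out ?A r z = D"
      then obtain j where j: "radius j \<le> r" "covered z 0 j" "out ?A r z = D" by blast
      have "out ?A r z = out ?A r z'"
        using j by (intro out_cong[of r z z' j] weights_eq eq)
      with cov[OF j(2,1) eq] j show "(\<exists>j. radius j \<le> r \<and> covered z' 0 j) \<and> out ?A r z' = D" by auto
    qed
    also have "{z \<in> space (ball_labellings r). (\<exists>j. radius j \<le> r \<and> covered z 0 j) \<and> out ?A r z = D}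
        = out ?A r -` {D} \<inter> space (restrict_space (ball_labellings r) (stops ?A r))"
      unfolding sp unfolding stops by blast
    finally show "out ?A r -` {D} \<inter> space (restrict_space (ball_labellings r) (stops ?A r))
        \<in> sets (restrict_space (ball_labellings r) (stops ?A r))"
      using sets_stops sets.sets_into_space[OF sets_stops]
      by (subst sets_restrict_space_iff) (simp_all add: sp Int_absorb2)
  qed
qed

lemma produces_toast_if_AE:
  assumes "AE x in labellings. \<forall>n. \<exists>i u. grid_ball (0 :: int ^ 'd::finite) n \<subseteq> core (s i) (weights x i) u"
  shows "produces_toast q (toast_alg :: ('d, (int ^ 'd) set) local_alg)"
  unfolding produces_toast_def
proof (intro conjI uniform_toast_alg)
  show "AE x in labellings. \<exists>\<D> :: (int ^ 'd) set set. is_toast q \<D> \<and>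
      (\<forall>v. \<exists>D. minimal_piece \<D> v D \<and> computes toast_alg x v ((\<lambda>u. u - v) ` D))"
    using assms
  proof eventually_elim
    case (elim x)
    have bounded: "weights x i u \<le> m i" for i u by (simp add: weights_def weight_le)
    let ?T = "\<Union>i. pieces (weights x) i"
    have toast: "is_toast q ?T" using elim bounded by (intro is_toast_pieces) auto
    have "\<exists>D. minimal_piece ?T v D \<and> computes toast_alg x v ((\<lambda>u. u - v) ` D)" for v
    proof -
      obtain E where "E \<in> ?T" "v \<in> E" using toast unfolding is_toast_def by blast
      then have "\<exists>j. covered x v j" unfolding covered_def by blast
      then have "covered x v (LEAST j. covered x v j)" by (rule LeastI_ex)
      then obtain D where D: "D \<in> pieces (weights x) (LEAST j. covered x v j)" "v \<in> D"
        by (auto simp: covered_def)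
      have "minimal_piece ?T v D"
        using bounded D by (intro minimal_piece_least_level[OF bounded D]) (auto simp: covered_def intro!: Least_le)
      moreover have "computes toast_alg x v ((\<lambda>u. u - v) ` D)"
        by (rule computes_least_piece[OF D Least_le])
      ultimately show ?thesis by blast
    qed
    with toast show ?case by blast
  qed
qed

end

section \<open>The tail of the coding radius\<close>

context toast_digits
begin

text \<open>The event itself is not measured but enclosed in an event \<open>E\<close> on the digits
  in one finite set \<open>V\<close>, large enough for all levels of \<open>I\<close>. Levels
  outside \<open>I\<close> are unrestricted and contribute the factor 1.\<close>

lemma unlucky_levels:
  fixes v :: "int ^ 'd::finite"
  assumes I: "finite I"
    and \<beta>: "\<And>i V. i \<in> I \<Longrightarrow> finite V \<Longrightarrow> grid_ball v (m i) \<subseteq> V \<Longrightarrow>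
      real (card {y \<in> PiE V (\<lambda>_. {..<N i}). no_winner (G i) V v (\<lambda>u. g i (y u))}) \<le> real (N i) ^ card V * \<beta> i"
  shows "\<exists>E\<in>sets labellings. {x. \<forall>i\<in>I. \<forall>u. v \<notin> core (G i) (weights x i) u} \<subseteq> E \<and>
    measure labellings E \<le> (\<Prod>i\<in>I. \<beta> i)"
proof -
  obtain k where k: "I \<subseteq> {..<k}" using finite_nat_bounded[OF I] by blast
  define V where "V = grid_ball v (\<Sum>i\<in>I. m i)"
  have V: "finite V" by (simp add: V_def)
  have ball: "grid_ball v (m i) \<subseteq> V" if "i \<in> I" for i
    using member_le_sum[of i I m] that I by (auto simp: V_def grid_ball_def)
  define B where "B i = {y \<in> PiE V (\<lambda>_. {..<N i}). i \<in> I \<longrightarrow> no_winner (G i) V v (\<lambda>u. g i (y u))}" for i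
  define E where "E = {x. \<forall>i<k. restrict (\<lambda>u. digit N i (x u)) V \<in> B i}"
  have B_sub: "B i \<subseteq> PiE V (\<lambda>_. {..<N i})" for i by (auto simp: B_def)
  have "E \<in> sets labellings"
    unfolding E_def by (intro measure_levels_le(1) radix_pos V B_sub)
  moreover have "{x. \<forall>i\<in>I. \<forall>u. v \<notin> core (G i) (weights x i) u} \<subseteq> E"
  proof
    fix x assume "x \<in> {x. \<forall>i\<in>I. \<forall>u. v \<notin> core (G i) (weights x i) u}"
    then have x: "v \<notin> core (G i) (weights x i) u" if "i \<in> I" for i u using that by blast
    have "no_winner (G i) V v (\<lambda>u. g i (restrict (\<lambda>u. digit N i (x u)) V u))" if "i \<in> I" for i
    proof -
      have "no_winner (G i) V v (weights x i)"
        using winner_core[of "G i" V v "weights x i" "m i"] x[OF that] ball[OF that]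
        by (auto simp: weights_def weight_le)
      then show ?thesis by (subst no_winner_cong[where \<delta>' = "weights x i"]) (auto simp: weights_def)
    qed
    then show "x \<in> E" by (auto simp: E_def B_def digit_less radix_pos)
  qed
  moreover have "measure labellings E \<le> (\<Prod>i\<in>I. \<beta> i)"
  proof -
    have "measure labellings E \<le> (\<Prod>i<k. card (B i) / real (N i) ^ card V)"
      unfolding E_def by (intro measure_levels_le(2) radix_pos V B_sub)
    also have "\<dots> \<le> (\<Prod>i<k. if i \<in> I then \<beta> i else 1)"
    proof (intro prod_mono conjI)
      fix i
      have pos: "real (N i) ^ card V > 0" using radix_pos[of i] by simp
      show "card (B i) / real (N i) ^ card V \<le> (if i \<in> I then \<beta> i else 1)"
      proof (cases "i \<in> I")
        case True
        then show ?thesis using \<beta>[OF True V ball[OF True]] pos by (simp add: B_def field_simps)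
      next
        case False
        then show ?thesis using V pos by (simp add: B_def card_PiE)
      qed
    qed simp
    also have "\<dots> = (\<Prod>i\<in>{..<k} \<inter> I. \<beta> i)" by (simp add: prod.inter_restrict)
    also have "{..<k} \<inter> I = I" using k by blast
    finally show ?thesis .
  qed
  ultimately show ?thesis by blast
qed

text \<open>Failure at all levels from \<open>k\<close> on has probability at most
  \<open>\<beta> i\<close> for each \<open>i \<ge> k\<close>, hence zero.\<close>

lemma AE_lucky_infinitely_often:
  fixes v :: "int ^ 'd::finite"
  assumes \<beta>: "\<And>i V. finite V \<Longrightarrow> grid_ball v (m i) \<subseteq> V \<Longrightarrow>
      real (card {y \<in> PiE V (\<lambda>_. {..<N i}). no_winner (G i) V v (\<lambda>u. g i (y u))}) \<le> real (N i) ^ card V * \<beta> i"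
    and lim: "\<beta> \<longlonglongrightarrow> 0"
  shows "AE x in labellings. \<forall>k. \<exists>i\<ge>k. \<exists>u. v \<in> core (G i) (weights x i) u"
proof (subst AE_all_countable, intro allI)
  fix k
  interpret prob_space "labellings :: (int ^ 'd \<Rightarrow> real) measure" by (rule prob_space_labellings)
  have "\<exists>E\<in>sets labellings. {x. \<forall>u. v \<notin> core (G i) (weights x i) u} \<subseteq> E \<and> measure labellings E \<le> \<beta> i" for i
    using unlucky_levels[of "{i}" v G \<beta>] \<beta> by simp
  then obtain E where E: "\<And>i. E i \<in> sets labellings" "\<And>i. {x. \<forall>u. v \<notin> core (G i) (weights x i) u} \<subseteq> E i"
    "\<And>i. measure labellings (E i) \<le> \<beta> i" by metis
  let ?E = "\<Inter>i\<in>{k..}. E i"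
  have sets: "?E \<in> sets labellings" using E(1) by (intro sets.countable_INT') auto
  have "measure labellings ?E \<le> 0"
  proof (rule LIMSEQ_le_const[OF lim])
    have "measure labellings ?E \<le> \<beta> i" if "k \<le> i" for i
    proof -
      have "measure labellings ?E \<le> measure labellings (E i)"
        using that by (intro finite_measure_mono E(1)) blast
      with E(3)[of i] show ?thesis by linarith
    qed
    then show "\<exists>n. \<forall>i\<ge>n. measure labellings ?E \<le> \<beta> i" by blast
  qed
  then have "emeasure labellings ?E = 0" by (simp add: emeasure_eq_measure measure_le_0_iff)
  then show "AE x in labellings. \<exists>i\<ge>k. \<exists>u. v \<in> core (G i) (weights x i) u"
    by (intro AE_I[of _ _ ?E] sets) (use E(2) in force)
qed

end

text \<open>The unit cancels: gap over size is \<open>1 / (4 * 4 ^ i)\<close>. The constant is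
  rounded up to a power of 2 for the product over the levels.\<close>

lemma card_no_winner_scale:
  fixes v :: "int ^ 'd::finite"
  assumes W: "weight_law (16 * toast_scale e i) i N (type_size e i) \<kappa> g (real C) v"
    and V: "finite V" "grid_ball v (128 * toast_scale e i * 4 ^ i) \<subseteq> V"
  shows "real (card {y \<in> PiE V (\<lambda>_. {..<N}). no_winner (16 * toast_scale e i) V v (\<lambda>u. g (y u))})
    \<le> real N ^ card V * (2 ^ Suc C / 4 ^ i)"
proof -
  have h: "2 * type_size e i i = 128 * toast_scale e i * 4 ^ i" by (simp add: type_size_def)
  have pos: "0 < toast_scale e i" by (simp add: toast_scale_def)
  have "real (card {y \<in> PiE V (\<lambda>_. {..<N}). no_winner (16 * toast_scale e i) V v (\<lambda>u. g (y u))})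
    \<le> real N ^ card V * (1 / 8 ^ Suc i + 2 * real C * real (16 * toast_scale e i) / real (type_size e i i))"
    using weight_law.card_no_winner[OF W V(1)] V(2) unfolding h .
  also have "\<dots> \<le> real N ^ card V * (2 ^ Suc C / 4 ^ i)"
  proof (intro mult_left_mono)
    have "1 / 8 ^ Suc i \<le> (1 :: real) / 4 ^ i"
    proof (intro divide_left_mono)
      have "(4 :: real) ^ i \<le> 8 ^ i" by (intro power_mono) auto
      also have "\<dots> \<le> 8 ^ Suc i" by simp
      finally show "(4 :: real) ^ i \<le> 8 ^ Suc i" .
    qed auto
    moreover have "2 * real C * real (16 * toast_scale e i) / real (type_size e i i) = (real C / 2) / 4 ^ i"
      using pos by (simp add: type_size_def field_simps)
    moreover have "1 + real C / 2 \<le> 2 ^ Suc C"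
    proof -
      have "real C < 2 ^ C" by (rule of_nat_less_two_power)
      moreover have "(1 :: real) \<le> 2 ^ C" "0 \<le> real C" by simp_all
      ultimately show ?thesis unfolding power_Suc by linarith
    qed
    then have "(1 + real C / 2) / 4 ^ i \<le> 2 ^ Suc C / 4 ^ i" by (intro divide_right_mono) auto
    ultimately show "1 / 8 ^ Suc i + 2 * real C * real (16 * toast_scale e i) / real (type_size e i i) \<le> 2 ^ Suc C / 4 ^ i"
      by (simp only: add_divide_distrib)
  qed auto
  finally show ?thesis .
qed

lemma prod_unlucky: "(\<Prod>i<k. 2 ^ c / 4 ^ i) = 2 powr (real (c + 1) * k - real k * k)"
proof (induction k)
  case (Suc k)
  have "(2 :: real) ^ c / 4 ^ k = 2 powr (real c - 2 * real k)"
  proof -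
    have "(4 :: real) ^ k = 2 ^ (2 * k)" by (simp add: power_mult)
    also have "\<dots> = 2 powr (2 * real k)" by (simp flip: powr_realpow)
    finally show ?thesis by (simp add: powr_diff powr_realpow)
  qed
  with Suc show ?case by (simp add: powr_add[symmetric] algebra_simps)
qed simp

text \<open>For \<open>k\<close> slightly above \<open>sqrt L + c\<close> the failure exponent
  \<open>k * (k - c - 1)\<close> exceeds \<open>L\<close>, while \<open>k * k\<close> exceeds
  \<open>L\<close> only by a multiple of \<open>sqrt L\<close>. As \<open>sqrt L\<close> is at least
  1, additive constants are absorbed as well.\<close>

lemma exponent_choice:
  fixes L :: real and c e :: nat
  assumes "1 \<le> L"
  defines "k \<equiv> nat \<lceil>sqrt L\<rceil> + c + 2"
  defines "K \<equiv> real (2 * (c + 3) + 8 + (c + 3) * (c + 3) + e + 1 + 8 * (c + 3))"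
  shows "real (c + 1) * k - real k * k < - L" "e + 1 + 8 * real k + real k * k \<le> L + K * sqrt L"
proof -
  define r where "r = sqrt L"
  have r: "1 \<le> r" "r * r = L" using assms(1) by (auto simp: r_def)
  have k: "r + c + 2 \<le> k" "k \<le> r + (c + 3)"
    using r(1) unfolding k_def r_def by linarith+
  have "(r + c + 2) * (r + 1) \<le> real k * (real k - (c + 1))"
    using k r by (intro mult_mono) auto
  moreover have "L < (r + c + 2) * (r + 1)"
    using r by (simp add: algebra_simps) (smt (verit) mult_nonneg_nonneg of_nat_0_le_iff)
  ultimately show "real (c + 1) * k - real k * k < - L" by (simp add: algebra_simps)
  \<comment> \<open>Since \<open>k \<le> r + a\<close>, expanding the square yields
    \<open>K = (2 * a + 8) + (a * a + e + 1 + 8 * a)\<close>.\<close>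
  define a where "a = real (c + 3)"
  have "real k * k \<le> (r + a) * (r + a)" using k r unfolding a_def by (intro mult_mono) auto
  also have "\<dots> = L + 2 * a * r + a * a" using r by (simp add: algebra_simps)
  finally have "e + 1 + 8 * real k + real k * k \<le> L + (2 * a + 8) * r + (a * a + e + 1 + 8 * a)"
    using k by (simp add: a_def algebra_simps)
  also have "\<dots> \<le> L + (2 * a + 8) * r + (a * a + e + 1 + 8 * a) * r"
    using r mult_left_mono[of 1 r "a * a + e + 1 + 8 * a"] by (simp add: a_def)
  also have "\<dots> = L + K * sqrt L" by (simp add: K_def a_def r_def algebra_simps)
  finally show "e + 1 + 8 * real k + real k * k \<le> L + K * sqrt L" .
qed

theorem theoremB1:
  shows "\<exists>q0 :: nat. \<forall>q\<ge>q0. \<exists>A :: ('d::finite, (int ^ 'd) set) local_alg.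
    produces_toast q A \<and>
    (\<exists>K :: real. \<exists>\<epsilon>0 > 0. \<forall>\<epsilon>. 0 < \<epsilon> \<and> \<epsilon> < \<epsilon>0 \<longrightarrow>
       (\<forall>v :: int ^ 'd. measure labellings {x \<in> space labellings.
          ereal_of_enat (coding_radius A x v) > ereal (1 / \<epsilon> * 2 powr (K * sqrt (log 2 (1 / \<epsilon>))))} < \<epsilon>))"
proof (intro exI[of _ 0] allI impI)
  fix q :: nat
  \<comment> \<open>The units are at least \<open>2 ^ e\<close> and thus dominate both the required
    distance \<open>q\<close> and the density constant.\<close>
  define e where "e = q + density_const (CARD('d))"
  have e: "q \<le> 2 ^ e" "density_const (CARD('d)) \<le> 2 ^ e"
    using less_exp[of e] unfolding e_def by linarith+
  define C where "C = density_const (CARD('d)) * 5 ^ CARD('d)"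
  define c where "c = Suc C"
  define N where "N i = type_size e i i ^ Suc (CARD('d))" for i
  have "\<exists>g. \<forall>i. (\<forall>y. g i y \<le> 128 * toast_scale e i * 4 ^ i) \<and>
    (\<forall>v :: int ^ 'd. weight_law (16 * toast_scale e i) i (N i) (type_size e i)
      (\<lambda>a. density_const (CARD('d)) * (4 ^ (i - a)) ^ Suc (CARD('d))) (g i) (real C) v)"
    unfolding N_def C_def by (intro choice allI exists_weight_law e(2))
  then obtain g where g: "\<And>i y. g i y \<le> 128 * toast_scale e i * 4 ^ i"
    "\<And>i v. weight_law (16 * toast_scale e i) i (N i) (type_size e i)
      (\<lambda>a. density_const (CARD('d)) * (4 ^ (i - a)) ^ Suc (CARD('d))) (g i) (real C) (v :: int ^ 'd)" by blast
  interpret toast_digits q "\<lambda>i. 8 * toast_scale e i" "\<lambda>i. 128 * toast_scale e i * 4 ^ i" "\<lambda>i. 2 * toast_scale e i" "toast_scale e" N g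
  proof (intro toast_digits.intro toast_scales_toast_scale e(1) toast_digits_axioms.intro g(1))
    show "0 < N i" for i by (simp add: N_def type_size_def toast_scale_def)
  qed (simp add: toast_scale_def)
  \<comment> \<open>Twice the gap of the cores: a point that wins by this much has a ball of radius
    \<open>4 * toast_scale e i\<close> inside the core.\<close>
  let ?G = "\<lambda>i. 16 * toast_scale e i"
  note no_winner_le = card_no_winner_scale[OF g(2), folded c_def]
  have lucky: "grid_ball v (4 * toast_scale e i) \<subseteq> core (8 * toast_scale e i) (weights x i) u"
    if "v \<in> core (?G i) (weights x i) u" for x u i and v :: "int ^ 'd"
    using core_shrink_gap[of v "8 * toast_scale e i" "4 * toast_scale e i" "weights x i" u] that by simp
  let ?A = "toast_alg :: ('d, (int ^ 'd) set) local_alg"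
  have "AE x in labellings. \<forall>k. \<exists>i\<ge>k. \<exists>u. (0 :: int ^ 'd) \<in> core (?G i) (weights x i) u"
  proof (rule AE_lucky_infinitely_often)
    show "(\<lambda>i. 2 ^ c / 4 ^ i) \<longlonglongrightarrow> (0 :: real)"
      using tendsto_mult_right_zero[OF LIMSEQ_power_zero[of "1 / 4 :: real"], of "2 ^ c"]
      by (simp add: power_divide)
  qed (use no_winner_le in blast)
  then have toast: "produces_toast q ?A"
  proof (intro produces_toast_if_AE, eventually_elim, intro allI)
    fix x n assume "\<forall>k. \<exists>i\<ge>k. \<exists>u. (0 :: int ^ 'd) \<in> core (?G i) (weights x i) u"
    then obtain i u where i: "n \<le> i" "0 \<in> core (?G i) (weights x i) u" by blast
    \<comment> \<open>Since the scale exceeds \<open>i\<close>, infinitely many lucky levels give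
      arbitrarily large balls in cores.\<close>
    have "i < 2 ^ i" by (rule less_exp)
    also have "(2 :: nat) ^ i \<le> toast_scale e i" unfolding toast_scale_def by (intro power_increasing) auto
    finally have "grid_ball (0 :: int ^ 'd) n \<subseteq> grid_ball 0 (4 * toast_scale e i)"
      using i(1) by (auto simp: grid_ball_def)
    with lucky[OF i(2)] show "\<exists>i u. grid_ball 0 n \<subseteq> core (8 * toast_scale e i) (weights x i) u" by blast
  qed
  define K where "K = real (2 * (c + 3) + 8 + (c + 3) * (c + 3) + e + 1 + 8 * (c + 3))"
  have tail: "measure labellings {x \<in> space labellings.
      ereal_of_enat (coding_radius ?A x v) > ereal (1 / \<epsilon> * 2 powr (K * sqrt (log 2 (1 / \<epsilon>))))} < \<epsilon>"
    if \<epsilon>: "0 < \<epsilon>" "\<epsilon> < 1 / 2" for \<epsilon> and v :: "int ^ 'd"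
  proof -
    interpret P: prob_space "labellings :: (int ^ 'd \<Rightarrow> real) measure" by (rule prob_space_labellings)
    define L where "L = log 2 (1 / \<epsilon>)"
    have L: "1 \<le> L" "2 powr L = 1 / \<epsilon>"
      using \<epsilon> unfolding L_def by (simp_all add: le_log_iff field_simps)
    define k where "k = nat \<lceil>sqrt L\<rceil> + c + 2"
    note exponents = exponent_choice(1)[OF L(1), where c = c, folded k_def]
      exponent_choice(2)[OF L(1), where c = c and e = e, folded k_def, folded K_def]
    obtain E where E: "E \<in> sets labellings" "{x. \<forall>i\<in>{..<k}. \<forall>u. v \<notin> core (?G i) (weights x i) u} \<subseteq> E"
      "measure labellings E \<le> (\<Prod>i<k. 2 ^ c / 4 ^ i)"
      using unlucky_levels[of "{..<k}" v ?G "\<lambda>i. 2 ^ c / 4 ^ i"] no_winner_le by blast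
    \<comment> \<open>If some level below \<open>k\<close> is lucky at \<open>v\<close>, the coding
      radius is at most \<open>2 * toast_scale e k\<close>, which the choice of \<open>k\<close>
      keeps within the threshold.\<close>
    have "{x \<in> space labellings. ereal_of_enat (coding_radius ?A x v) > ereal (1 / \<epsilon> * 2 powr (K * sqrt L))} \<subseteq> E"
    proof (intro subsetI, rule ccontr)
      fix x assume x: "x \<in> {x \<in> space labellings. ereal_of_enat (coding_radius ?A x v) > ereal (1 / \<epsilon> * 2 powr (K * sqrt L))}"
        and "x \<notin> E"
      then have "x \<notin> {x. \<forall>i\<in>{..<k}. \<forall>u. v \<notin> core (?G i) (weights x i) u}" using E(2) by blast
      then obtain i u where i: "i < k" "v \<in> core (?G i) (weights x i) u" by auto
      have v: "v \<in> core (8 * toast_scale e i) (weights x i) u"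
        using lucky[OF i(2)] by (auto simp: grid_ball_def)
      then have "engulf (weights x) i (core (8 * toast_scale e i) (weights x i) u) \<in> pieces (weights x) i"
        by (auto simp: pieces_def)
      with v have "covered x v i" unfolding covered_def using subset_engulf by blast
      then have "coding_radius ?A x v \<le> enat (radius i)" by (rule coding_radius_le)
      also have "radius i \<le> 2 * toast_scale e k" using i(1) by (simp add: radius_def tau_mono)
      finally have "ereal_of_enat (coding_radius ?A x v) \<le> ereal (real (2 * toast_scale e k))"
        using ereal_of_enat_le_iff[of "coding_radius ?A x v" "enat (2 * toast_scale e k)"] by simp
      also have "2 * toast_scale e k = 2 ^ (e + 1 + 8 * k + k * k)" by (simp add: toast_scale_def power_add)
      also have "real (2 ^ (e + 1 + 8 * k + k * k)) = 2 powr (e + 1 + 8 * real k + real k * k)"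
        using powr_realpow[of 2 "e + 1 + 8 * k + k * k"] by (simp add: add.assoc add.left_commute)
      also have "\<dots> \<le> 2 powr (L + K * sqrt L)" using exponents(2) by (intro powr_mono) auto
      also have "\<dots> = 1 / \<epsilon> * 2 powr (K * sqrt L)" using L(2) by (simp add: powr_add)
      finally show False using x by simp
    qed
    then have "measure labellings {x \<in> space labellings. ereal_of_enat (coding_radius ?A x v)
        > ereal (1 / \<epsilon> * 2 powr (K * sqrt L))} \<le> measure labellings E"
      using E(1) by (rule P.finite_measure_mono)
    also have "\<dots> \<le> 2 powr (real (c + 1) * k - real k * k)" using E(3) unfolding prod_unlucky .
    also have "\<dots> < 2 powr (- L)" using exponents(1) by (intro powr_less_mono) auto
    also have "\<dots> = \<epsilon>" using L(2) \<epsilon> by (simp add: powr_minus)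
    finally show ?thesis unfolding L_def .
  qed
  show "\<exists>A :: ('d, (int ^ 'd) set) local_alg. produces_toast q A \<and>
    (\<exists>K :: real. \<exists>\<epsilon>0 > 0. \<forall>\<epsilon>. 0 < \<epsilon> \<and> \<epsilon> < \<epsilon>0 \<longrightarrow>
       (\<forall>v :: int ^ 'd. measure labellings {x \<in> space labellings.
          ereal_of_enat (coding_radius A x v) > ereal (1 / \<epsilon> * 2 powr (K * sqrt (log 2 (1 / \<epsilon>))))} < \<epsilon>))"
    using toast tail by (intro exI[of _ ?A] conjI exI[of _ K] exI[of _ "1 / 2 :: real"]) auto
qed

end
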